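(* Let $1<p<+\infty$, let $a\in C[0,1]$ be positive, and let $\alpha,\beta$ be two continuous functions defined on $[0,1]$. Consider the half-quasilinear problem $$(H)\qquad -\left(\varphi_p(u')\right)'=\lambda a(x)\varphi_p(u)+\alpha\varphi_p(u^+)+\beta\varphi_p(u^-),\ x\in(0,1),\qquad u(0)=u(1)=0 .$$ There exist two sequences of simple half-eigenvalues for problem $(H)$, $\lambda_1^+<\lambda_2^+<\cdots<\lambda_k^+<\cdots$ and $\lambda_1^-<\lambda_2^-<\cdots<\lambda_k^-<\cdots$. The corresponding half-linear solutions are in $\{\lambda_k^+\}\times S_k^+$ and $\{\lambda_k^-\}\times S_k^-$. Furthermore, aside from these solutions and the trivial ones, there are no other solutions of problem $(H)$.
   Context: $\varphi_p(s)=|s|^{p-2}s$; $u^+=\max\{u,0\}$, $u^-=-\min\{u,0\}$; $\lambda$ is a real parameter. $E=\{u\in C^1[0,1] : u(0)=u(1)=0\}$ with norm $\|u\|=\max_{x\in[0,1]}|u(x)|+\max_{x\in[0,1]}|u'(x)|$. For $k\in\mathbb{N}=\{1,2,\dots\}$, $S_k^+$ denotes the set of functions in $E$ which have exactly $k-1$ interior nodal (i.e. non-degenerate) zeros in $(0,1)$ and are positive near $x=0$, and $S_k^-=-S_k^+$. Solutions of $(H)$ are pairs $(\lambda,u)\in\mathbb{R}\times E$ satisfying $(H)$; the trivial ones are those with $u\equiv0$. A number $\lambda$ is a half-eigenvalue of $(H)$ if there exists a nontrivial solution $(\lambda,u_\lambda)$. A half-eigenvalue $\lambda$ is said to be simple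 if $v=cu_\lambda$, $c>0$, for all solutions $(\lambda,v)$ of $(H)$. The half-linear solutions corresponding to $\lambda_k^\nu$ ($\nu\in\{+,-\}$) are the solutions $\{(\lambda_k^\nu,c\,u_k^\nu) : c>0\}$ generated, by positive $(p-1)$-homogeneity of $(H)$, from a nontrivial solution $(\lambda_k^\nu,u_k^\nu)$.
   Formalization: "Simple" is required only among nontrivial solutions with the same sign near 0; as literally defined (v = c u_λ, c > 0, for all solutions) it fails, e.g. for α = β = 0, where u and −u both solve (H) with the same λ. *)

theory Defs
  imports "HOL-Analysis.Analysis"
begin

text \<open>Functions on \<open>[0,1]\<close> are represented by functions of type \<^typ>\<open>real \<Rightarrow> real\<close> whose values
  outside \<open>[0,1]\<close> are irrelevant.  Accordingly no definition below looks at these values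
  and equality of such functions always means equality on \<open>[0,1]\<close>.\<close>

definition phi :: "real \<Rightarrow> real \<Rightarrow> real" where
  "phi p s = \<bar>s\<bar> powr (p - 2) * s"

definition pos_part :: "real \<Rightarrow> real" where
  "pos_part s = max s 0"

definition neg_part :: "real \<Rightarrow> real" where
  "neg_part s = - min s 0"

text \<open>The derivative relative to \<open>[0,1]\<close>: one-sided at the end points.\<close>

definition deriv01 :: "(real \<Rightarrow> real) \<Rightarrow> real \<Rightarrow> real" where
  "deriv01 u x = vector_derivative u (at x within {0..1})"

definition E :: "(real \<Rightarrow> real) set" where
  "E = {u. u differentiable_on {0..1} \<and> continuous_on {0..1} (deriv01 u) \<and> u 0 = 0 \<and> u 1 = 0}"

text \<open>The zeros of \<open>u\<close> in \<open>(0,1)\<close> are all non-degenerate and there are exactly \<open>k - 1\<close> of them.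
  The index \<open>k\<close> is meant to be at least 1.\<close>

definition S_plus :: "nat \<Rightarrow> (real \<Rightarrow> real) set" where
  "S_plus k = {u \<in> E.
     finite {x \<in> {0<..<1}. u x = 0} \<and> card {x \<in> {0<..<1}. u x = 0} = k - 1 \<and>
     (\<forall>x \<in> {0<..<1}. u x = 0 \<longrightarrow> deriv01 u x \<noteq> 0) \<and>
     (\<forall>\<^sub>F x in at_right 0. 0 < u x)}"

definition S_minus :: "nat \<Rightarrow> (real \<Rightarrow> real) set" where
  "S_minus k = (\<lambda>u x. - u x) ` S_plus k"

definition solution ::
  "real \<Rightarrow> (real \<Rightarrow> real) \<Rightarrow> (real \<Rightarrow> real) \<Rightarrow> (real \<Rightarrow> real) \<Rightarrow> real \<Rightarrow> (real \<Rightarrow> real) \<Rightarrow> bool" where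
  "solution p a \<alpha> \<beta> lam u \<longleftrightarrow> u \<in> E \<and>
     (\<forall>x \<in> {0<..<1}. ((\<lambda>t. phi p (deriv01 u t)) has_real_derivative
        - (lam * a x * phi p (u x) + \<alpha> x * phi p (pos_part (u x)) + \<beta> x * phi p (neg_part (u x))))
        (at x))"

definition nontrivial_solution ::
  "real \<Rightarrow> (real \<Rightarrow> real) \<Rightarrow> (real \<Rightarrow> real) \<Rightarrow> (real \<Rightarrow> real) \<Rightarrow> real \<Rightarrow> (real \<Rightarrow> real) \<Rightarrow> bool" where
  "nontrivial_solution p a \<alpha> \<beta> lam u \<longleftrightarrow>
     solution p a \<alpha> \<beta> lam u \<and> \<not> (\<forall>x \<in> {0..1}. u x = 0)"

definition half_eigenvalue ::
  "real \<Rightarrow> (real \<Rightarrow> real) \<Rightarrow> (real \<Rightarrow> real) \<Rightarrow> (real \<Rightarrow> real) \<Rightarrow> real \<Rightarrow> bool" where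
  "half_eigenvalue p a \<alpha> \<beta> lam \<longleftrightarrow> (\<exists>u. nontrivial_solution p a \<alpha> \<beta> lam u)"

text \<open>Simplicity compares nontrivial solutions having the same sign near 0.  Without this
  restriction a number occurring in both sequences of half-eigenvalues would never be simple:
  for \<open>\<alpha> = \<beta> = 0\<close>, say, \<open>- u\<close> solves the problem along with \<open>u\<close>, but is not a positive
  multiple of it.\<close>

definition simple_half_eigenvalue ::
  "real \<Rightarrow> (real \<Rightarrow> real) \<Rightarrow> (real \<Rightarrow> real) \<Rightarrow> (real \<Rightarrow> real) \<Rightarrow> real \<Rightarrow> bool" where
  "simple_half_eigenvalue p a \<alpha> \<beta> lam \<longleftrightarrow> half_eigenvalue p a \<alpha> \<beta> lam \<and>
     (\<forall>u v. nontrivial_solution p a \<alpha> \<beta> lam u \<and> nontrivial_solution p a \<alpha> \<beta> lam v \<and>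
        (\<forall>\<^sub>F x in at_right 0. 0 < u x * v x) \<longrightarrow>
        (\<exists>c > 0. \<forall>x \<in> {0..1}. v x = c * u x))"

text \<open>The half-line \<open>{(lam, c u) : c > 0}\<close>.\<close>

definition half_line :: "real \<Rightarrow> (real \<Rightarrow> real) \<Rightarrow> (real \<times> (real \<Rightarrow> real)) set" where
  "half_line lam u = {(lam, v) | v. \<exists>c > 0. \<forall>x \<in> {0..1}. v x = c * u x}"

end

theory Submission
  imports Defs
begin

text \<open>
  Put \<open>v = \<phi>\<^sub>p(u')\<close> and let \<open>q\<close> be the exponent conjugate to \<open>p\<close>.  The equation becomes the planar
  system \<open>u' = \<phi>\<^sub>q(v)\<close>, \<open>v' = - F(\<lambda>,x,u)\<close>, where \<open>F(\<lambda>,x,u)\<close> is the right-hand side of the equation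
  (\<open>rhs\<close> below, also called \<open>force\<close>).
  It is invariant under the scalings \<open>(u, v) \<mapsto> (c u, c\<^sup>p\<^sup>-\<^sup>1 v)\<close>, \<open>c > 0\<close>, so what matters is the motion of the
  orbits of these scalings.  Every orbit other than the origin meets the unit circle exactly once, and
  this suggests the polar coordinates
    \<open>u = r sin \<theta>\<close>, \<open>v = r\<^sup>p\<^sup>-\<^sup>1 cos \<theta>\<close>
  with the ordinary sine and cosine.  In these coordinates the angle obeys a scalar equation
  \<open>\<theta>' = rot \<lambda> x \<theta>\<close> that does not contain \<open>r\<close> and whose right-hand side is Lipschitz in \<open>\<theta>\<close>, and \<open>r\<close> is the exponential of an integral.  The solution with
  \<open>\<theta>(0) = 0\<close> yields the shooting solution \<open>U \<lambda>\<close> with \<open>u(0) = 0\<close>, \<open>v(0) = 1\<close>.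

  The planar system itself is not Lipschitz on the axes, since \<open>\<phi>\<^sub>p\<close> or \<open>\<phi>\<^sub>q\<close> is not Lipschitz at 0 unless
  \<open>p = 2\<close>.  Its initial value problems nevertheless have at most one solution away from the origin: where \<open>v > 0\<close>,
  the scaling invariant quotient \<open>u / \<phi>\<^sub>q(v)\<close> satisfies a locally Lipschitz equation, and where \<open>u > 0\<close> so
  does \<open>v / \<phi>\<^sub>p(u)\<close>; negative values are reflected to positive ones
  (\<open>chart_unique\<close>, \<open>planar_unique\<close>).  A solution that starts at the origin stays there by an energy estimate
  (\<open>planar_solution_zero\<close>).  Hence the nontrivial solutions of the boundary value problem
  with \<open>u'(0) > 0\<close> are exactly the functions \<open>c \<cdot> U \<lambda>\<close>, \<open>c > 0\<close>, for those \<open>\<lambda>\<close> for which \<open>\<theta>(1)\<close> is a multiple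
  of \<open>\<pi>\<close>; this contains the simplicity.

  Where \<open>sin \<theta> = 0\<close> one has \<open>\<theta>' = 1\<close>, so \<open>\<theta>\<close> passes every multiple of \<open>\<pi>\<close> upwards and only once.  Thus \<open>\<theta>(1) = k \<pi>\<close>
  with \<open>k \<ge> 1\<close> means that \<open>U \<lambda>\<close> has exactly \<open>k - 1\<close> interior zeros, at which \<open>v \<noteq> 0\<close>.
  The number \<open>\<theta>(1)\<close> depends continuously on \<open>\<lambda>\<close>; it increases strictly because \<open>a > 0\<close>; it is below \<open>\<pi>\<close> for
  very negative \<open>\<lambda>\<close> because \<open>\<theta>\<close> cannot pass \<open>\<pi>/2\<close> then; and it is unbounded above because the time that
  \<open>\<theta>\<close> needs for one half turn tends to 0 as \<open>\<lambda>\<close> grows.  So for each \<open>k \<ge> 1\<close> exactly one \<open>\<lambda>\<close> satisfies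
  \<open>\<theta>(1) = k \<pi>\<close>, and this is \<open>\<lambda>\<^sub>k\<^sup>+\<close>.

  Solutions with \<open>u'(0) < 0\<close> are covered by symmetry: \<open>- u\<close> solves the problem in which
  \<open>(\<alpha>, \<beta>)\<close> is replaced by \<open>(- \<beta>, - \<alpha>)\<close>.
\<close>

section \<open>Odd powers, positive and negative parts\<close>

lemma phi_zero [simp]: "phi p 0 = 0"
  by (simp add: phi_def)

lemma phi_minus [simp]: "phi p (- s) = - phi p s"
  by (simp add: phi_def)

lemma phi_pos: "0 < s \<Longrightarrow> phi p s = s powr (p - 1)"
  using powr_add[of s "p - 2" 1] by (simp add: phi_def)

lemma phi_neg: "s < 0 \<Longrightarrow> phi p s = - ((- s) powr (p - 1))"
  using phi_pos[of "- s" p] by simp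

lemma phi_one [simp]: "phi p 1 = 1"
  by (simp add: phi_def)

lemma phi_eq_0_iff [simp]: "phi p s = 0 \<longleftrightarrow> s = 0"
  by (auto simp: phi_def)

lemma phi_mult: "phi p (c * s) = phi p c * phi p s"
  by (simp add: phi_def abs_mult powr_mult)

lemma mult_phi: "s * phi p s = \<bar>s\<bar> powr p"
  by (cases s "0::real" rule: linorder_cases)
    (use powr_add[of "\<bar>s\<bar>" "p - 1" 1] in \<open>auto simp: phi_pos phi_neg mult.commute\<close>)

lemma abs_phi: "s \<noteq> 0 \<Longrightarrow> \<bar>phi p s\<bar> = \<bar>s\<bar> powr (p - 1)"
  by (cases s "0::real" rule: linorder_cases)
    (auto simp: phi_pos phi_neg)

lemma phi_phi_conjugate:
  assumes "(p - 1) * (q - 1) = 1"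
  shows "phi p (phi q s) = s"
proof (cases s "0::real" rule: linorder_cases)
  case less
  then show ?thesis using assms by (simp add: phi_neg phi_pos powr_powr mult.commute)
next
  case greater
  then show ?thesis using assms by (simp add: phi_pos powr_powr mult.commute)
qed simp

lemma continuous_phi:
  assumes "1 < p"
  shows "continuous_on S (phi p)"
proof -
  have "phi p s = max s 0 powr (p - 1) - max (- s) 0 powr (p - 1)" for s
    by (cases s "0::real" rule: linorder_cases) (auto simp: max_def phi_pos phi_neg)
  then have "phi p = (\<lambda>s. max s 0 powr (p - 1) - max (- s) 0 powr (p - 1))"
    by auto
  moreover have "continuous_on S (\<lambda>s. max s 0 powr (p - 1) - max (- s) 0 powr (p - 1))"
    using assms by (intro continuous_intros continuous_on_powr') auto
  ultimately show ?thesis by simp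
qed

lemma continuous_on_phi [continuous_intros]:
  "1 < p \<Longrightarrow> continuous_on S f \<Longrightarrow> continuous_on S (\<lambda>x. phi p (f x))"
  using continuous_on_compose2[OF continuous_phi[of p UNIV], of S f] by auto

lemma continuous_on_pos_part [continuous_intros]:
  "continuous_on S f \<Longrightarrow> continuous_on S (\<lambda>x. pos_part (f x))"
  unfolding pos_part_def by (intro continuous_intros)

lemma continuous_on_neg_part [continuous_intros]:
  "continuous_on S f \<Longrightarrow> continuous_on S (\<lambda>x. neg_part (f x))"
  unfolding neg_part_def by (intro continuous_intros)

lemma abs_powr_has_real_derivative:
  assumes "1 < p"
  shows "((\<lambda>s. \<bar>s\<bar> powr p) has_real_derivative p * phi p s) (at s)"
proof (cases s "0::real" rule: linorder_cases)
  case less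
  have "((\<lambda>s. (- s) powr p) has_real_derivative p * phi p s) (at s)"
    using less by (auto simp: phi_neg intro!: derivative_eq_intros)
  moreover have "\<forall>\<^sub>F t in nhds s. \<bar>t\<bar> powr p = (- t) powr p"
    using less eventually_nhds_in_open[of "{..<0}" s] by (auto elim!: eventually_mono)
  ultimately show ?thesis
    using DERIV_cong_ev[OF refl _ refl, of "\<lambda>s. \<bar>s\<bar> powr p" "\<lambda>s. (- s) powr p" s] by blast
next
  case equal
  \<comment> \<open>At 0 the difference quotient is \<open>phi p\<close> itself.\<close>
  have lim: "(phi p \<longlongrightarrow> 0) (at 0)"
    using continuous_phi[OF assms, of UNIV] unfolding continuous_on_def
    by (metis UNIV_I phi_zero)
  have "phi p h = (\<bar>0 + h\<bar> powr p - \<bar>0\<bar> powr p) / h" if "h \<noteq> 0" for h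
    using that by (simp flip: mult_phi)
  then have "\<forall>\<^sub>F h in at 0. phi p h = (\<bar>0 + h\<bar> powr p - \<bar>0\<bar> powr p) / h"
    by (simp only: eventually_at_filter) simp
  with lim have "((\<lambda>s. \<bar>s\<bar> powr p) has_real_derivative 0) (at 0)"
    unfolding DERIV_def by (rule Lim_transform_eventually)
  then show ?thesis using equal by simp
next
  case greater
  have "((\<lambda>s. s powr p) has_real_derivative p * phi p s) (at s)"
    using greater by (auto simp: phi_pos intro!: derivative_eq_intros)
  moreover have "\<forall>\<^sub>F t in nhds s. \<bar>t\<bar> powr p = t powr p"
    using greater eventually_nhds_in_open[of "{0<..}" s] by (auto elim!: eventually_mono)
  ultimately show ?thesis
    using DERIV_cong_ev[OF refl _ refl, of "\<lambda>s. \<bar>s\<bar> powr p" "\<lambda>s. s powr p" s] by blast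
qed

lemma powr_lipschitz:
  fixes x y :: real
  assumes "1 < p" "0 \<le> x" "x \<le> K" "0 \<le> y" "y \<le> K"
  shows "\<bar>x powr p - y powr p\<bar> \<le> p * K powr (p - 1) * \<bar>x - y\<bar>"
proof -
  have *: "y powr p - x powr p \<le> p * K powr (p - 1) * (y - x)"
    if "0 \<le> x" "x \<le> y" "y \<le> K" for x y :: real
  proof -
    have "y powr p - p * K powr (p - 1) * y \<le> x powr p - p * K powr (p - 1) * x"
    proof (rule DERIV_nonpos_imp_decreasing_open[of x y])
      fix t assume t: "x < t" "t < y"
      have "((\<lambda>t. t powr p - p * K powr (p - 1) * t) has_real_derivative
          p * t powr (p - 1) - p * K powr (p - 1)) (at t)"
        using t that by (auto intro!: derivative_eq_intros)
      moreover have "t powr (p - 1) \<le> K powr (p - 1)"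
        using t that assms by (intro powr_mono2) auto
      ultimately show "\<exists>d. ((\<lambda>t. t powr p - p * K powr (p - 1) * t) has_real_derivative d) (at t) \<and> d \<le> 0"
        using assms(1) by (intro exI[of _ "p * t powr (p - 1) - p * K powr (p - 1)"]) auto
    next
      show "continuous_on {x..y} (\<lambda>t. t powr p - p * K powr (p - 1) * t)"
        using that assms(1) by (intro continuous_intros continuous_on_powr') auto
    qed (use that in auto)
    then show ?thesis by (simp add: algebra_simps)
  qed
  have m: "x powr p \<le> y powr p" if "0 \<le> x" "x \<le> y" for x y :: real
    using that assms(1) by (intro powr_mono2) auto
  show ?thesis
    using *[of x y] *[of y x] m[of x y] m[of y x] assms by (cases "x \<le> y") auto
qed

lemma mult_phi_pos_part: "s * phi p (pos_part s) = pos_part s powr p"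
  using mult_phi[of "pos_part s" p] by (cases "0 < s") (auto simp: pos_part_def max_def)

lemma mult_phi_neg_part: "s * phi p (neg_part s) = - (neg_part s powr p)"
  using mult_phi[of "neg_part s" p] by (cases "s < 0") (auto simp: neg_part_def min_def)

lemma pos_part_mult: "0 < c \<Longrightarrow> pos_part (s * c) = pos_part s * c"
  by (auto simp: pos_part_def max_def zero_less_mult_iff mult_less_0_iff not_le)

lemma neg_part_mult: "0 < c \<Longrightarrow> neg_part (s * c) = neg_part s * c"
  by (auto simp: neg_part_def min_def zero_less_mult_iff mult_less_0_iff not_le mult_le_0_iff)

lemma pos_part_lipschitz: "\<bar>pos_part s - pos_part t\<bar> \<le> \<bar>s - t\<bar>"
  by (auto simp: pos_part_def)

lemma neg_part_lipschitz: "\<bar>neg_part s - neg_part t\<bar> \<le> \<bar>s - t\<bar>"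
  by (auto simp: neg_part_def)

lemma pos_part_bounds: "0 \<le> pos_part s" "pos_part s \<le> \<bar>s\<bar>"
  by (auto simp: pos_part_def)

lemma neg_part_bounds: "0 \<le> neg_part s" "neg_part s \<le> \<bar>s\<bar>"
  by (auto simp: neg_part_def)

lemma pos_part_minus [simp]: "pos_part (- s) = neg_part s"
  and neg_part_minus [simp]: "neg_part (- s) = pos_part s"
  by (auto simp: pos_part_def neg_part_def)

lemma phi_decompose: "phi p s = phi p (pos_part s) - phi p (neg_part s)"
  by (cases "0 \<le> s") (auto simp: pos_part_def neg_part_def max_def min_def)

section \<open>Scalar differential inequalities and equations\<close>

text \<open>The function \<open>f x * exp (- K * x)\<close> is nonincreasing.  The estimate can also be
  read backwards: if \<open>f \<le> 0\<close> and \<open>f b = 0\<close>, then \<open>f a = 0\<close>.\<close>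

lemma gronwall:
  fixes f :: "real \<Rightarrow> real"
  assumes "a \<le> b" "continuous_on {a..b} f"
    and deriv: "\<And>x. a < x \<Longrightarrow> x < b \<Longrightarrow> \<exists>d. (f has_real_derivative d) (at x) \<and> d \<le> K * f x"
  shows "f b \<le> f a * exp (K * (b - a))"
proof -
  have "f b * exp (- K * b) \<le> f a * exp (- K * a)"
  proof (rule DERIV_nonpos_imp_decreasing_open[OF assms(1)])
    fix x assume x: "a < x" "x < b"
    then obtain d where d: "(f has_real_derivative d) (at x)" "d \<le> K * f x"
      using deriv by blast
    have "((\<lambda>x. f x * exp (- K * x)) has_real_derivative (d - K * f x) * exp (- K * x)) (at x)"
      by (rule derivative_eq_intros d refl | simp add: algebra_simps)+
    moreover have "(d - K * f x) * exp (- K * x) \<le> 0"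
      using d(2) by (simp add: mult_le_0_iff)
    ultimately show "\<exists>d. ((\<lambda>x. f x * exp (- K * x)) has_real_derivative d) (at x) \<and> d \<le> 0"
      by blast
  next
    show "continuous_on {a..b} (\<lambda>x. f x * exp (- K * x))"
      using assms(2) by (intro continuous_intros)
  qed
  then have "f b * exp (- K * b) * exp (K * b) \<le> f a * exp (- K * a) * exp (K * b)"
    by (rule mult_right_mono) simp
  then show ?thesis
    by (simp add: mult.assoc flip: exp_add) (simp add: algebra_simps)
qed

text \<open>Suppose \<open>y\<close> ends above \<open>z\<close>.  After the last point at which \<open>y \<le> z\<close> the difference \<open>y - z\<close> is
  positive and satisfies the hypothesis of Gronwall's inequality, but it starts from a value that is not positive.\<close>

lemma comparison:
  fixes y z :: "real \<Rightarrow> real"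
  assumes "a \<le> b" "continuous_on {a..b} y" "continuous_on {a..b} z" "y a \<le> z a"
    and deriv: "\<And>x. a < x \<Longrightarrow> x < b \<Longrightarrow> \<exists>y' z'. (y has_real_derivative y') (at x) \<and>
      (z has_real_derivative z') (at x) \<and> y' - z' \<le> L * \<bar>y x - z x\<bar>"
  shows "y b \<le> z b"
proof (rule ccontr)
  assume *: "\<not> y b \<le> z b"
  define S where "S = {x \<in> {a..b}. y x \<le> z x}"
  have "closed ({a..b} \<inter> (\<lambda>x. y x - z x) -` {..0})"
    using assms(2,3) by (intro continuous_closed_preimage continuous_intros) auto
  moreover have "{a..b} \<inter> (\<lambda>x. y x - z x) -` {..0} = S" by (auto simp: S_def)
  ultimately have "closed S" by simp
  define x0 where "x0 = Sup S"
  have "a \<in> S" "bdd_above S" using assms by (auto simp: S_def intro!: bdd_aboveI[of _ b])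
  then have x0: "x0 \<in> S"
    unfolding x0_def using \<open>closed S\<close> by (intro closed_contains_Sup) auto
  have gt: "z x < y x" if "x0 < x" "x \<le> b" for x
  proof -
    have "x \<notin> S" using that cSup_upper[OF _ \<open>bdd_above S\<close>, of x] by (auto simp: x0_def)
    then show ?thesis using that x0 by (auto simp: S_def)
  qed
  have "(y b - z b) \<le> (y x0 - z x0) * exp (L * (b - x0))"
  proof (rule gronwall)
    show "x0 \<le> b" using x0 by (auto simp: S_def)
    show "continuous_on {x0..b} (\<lambda>x. y x - z x)"
      using x0 by (auto simp: S_def intro!: continuous_intros intro: continuous_on_subset[OF assms(2)] continuous_on_subset[OF assms(3)])
    fix x assume "x0 < x" "x < b"
    then obtain y' z' where "(y has_real_derivative y') (at x)" "(z has_real_derivative z') (at x)"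
      "y' - z' \<le> L * \<bar>y x - z x\<bar>"
      using deriv[of x] x0 by (auto simp: S_def)
    then show "\<exists>d. ((\<lambda>x. y x - z x) has_real_derivative d) (at x) \<and> d \<le> L * (y x - z x)"
      using gt[of x] \<open>x0 < x\<close> \<open>x < b\<close> by (auto intro!: exI[of _ "y' - z'"] derivative_intros)
  qed
  also have "\<dots> \<le> 0" using x0 by (auto simp: S_def mult_le_0_iff)
  finally show False using * by simp
qed

text \<open>At \<open>a\<close> or just to the right of it there is a point where \<open>g > 0\<close>.  If \<open>g b \<le> 0\<close>, then at the first zero
  after this point \<open>g\<close> comes down from positive values, against the sign of its derivative there.\<close>

lemma crosses_upwards:
  fixes g :: "real \<Rightarrow> real"
  assumes ab: "a < b" and g: "continuous_on {a..b} g" "0 \<le> g a"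
    and deriv: "\<And>x. a \<le> x \<Longrightarrow> x \<le> b \<Longrightarrow> g x = 0 \<Longrightarrow>
      \<exists>d > 0. (g has_real_derivative d) (at x within {a..b})"
  shows "0 < g b"
proof (rule ccontr)
  assume *: "\<not> 0 < g b"
  have "\<exists>c. a \<le> c \<and> c < b \<and> 0 < g c"
  proof (cases "g a = 0")
    case True
    then obtain e where e: "e > 0" "\<forall>h>0. a + h \<in> {a..b} \<longrightarrow> h < e \<longrightarrow> g a < g (a + h)"
      using deriv[of a] ab has_real_derivative_pos_inc_right[of g _ a "{a..b}"] by force
    define h where "h = min (e / 2) ((b - a) / 2)"
    have h: "0 < h" "h < e" "a + h < b"
      using ab e(1) by (auto simp: h_def min_def field_simps)
    then show ?thesis
      using True e(2) by (intro exI[of _ "a + h"]) auto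
  qed (use g ab in auto)
  then obtain c where c: "a \<le> c" "c < b" "0 < g c" by blast
  define S where "S = {x \<in> {c..b}. g x \<le> 0}"
  have "continuous_on {c..b} g" using g(1) by (rule continuous_on_subset) (use c in auto)
  then have "closed ({c..b} \<inter> g -` {..0})"
    by (intro continuous_closed_preimage) auto
  moreover have "{c..b} \<inter> g -` {..0} = S" by (auto simp: S_def)
  ultimately have "closed S" by simp
  define x0 where "x0 = Inf S"
  have "b \<in> S" "bdd_below S" using * c by (auto simp: S_def intro!: bdd_belowI[of _ c])
  then have x0: "x0 \<in> S"
    unfolding x0_def using \<open>closed S\<close> by (intro closed_contains_Inf) auto
  have pos: "0 < g x" if "c \<le> x" "x < x0" for x
  proof -
    have "x \<notin> S" using that cInf_lower[OF _ \<open>bdd_below S\<close>, of x] by (auto simp: x0_def)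
    then show ?thesis using that x0 by (auto simp: S_def)
  qed
  have "c < x0" using x0 c by (cases "c = x0") (auto simp: S_def)
  have "continuous_on {c..x0} g" using g(1) by (rule continuous_on_subset) (use c x0 in \<open>auto simp: S_def\<close>)
  then have "0 \<le> g x0"
    using pos \<open>c < x0\<close> continuous_ge_on_closure[of "{c<..<x0}" g x0 0] by (auto simp: less_imp_le)
  then have "g x0 = 0" using x0 by (auto simp: S_def)
  then obtain e where e: "e > 0" "\<forall>h>0. x0 - h \<in> {a..b} \<longrightarrow> h < e \<longrightarrow> g (x0 - h) < g x0"
    using deriv[of x0] x0 c has_real_derivative_pos_inc_left[of g _ x0 "{a..b}"] by (force simp: S_def)
  define h where "h = min (e / 2) ((x0 - c) / 2)"
  have h: "0 < h" "h < e" "c \<le> x0 - h" "x0 - h < x0"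
    using e(1) \<open>c < x0\<close> by (auto simp: h_def min_def field_simps)
  then have "g (x0 - h) < g x0" using e(2) c x0 by (auto simp: S_def)
  then show False using pos[of "x0 - h"] h \<open>g x0 = 0\<close> by simp
qed

text \<open>The infimum of the points where \<open>d \<noteq> 0\<close> is, by continuity, a zero of \<open>d\<close>; a zero that
  propagates to the right contradicts the choice of the infimum.\<close>

lemma vanishes_if_zero_propagates:
  fixes d :: "real \<Rightarrow> real"
  assumes "continuous_on {a..b} d" "d a = 0"
    and step: "\<And>x. a \<le> x \<Longrightarrow> x < b \<Longrightarrow> d x = 0 \<Longrightarrow>
      \<exists>e > x. \<forall>y. x \<le> y \<and> y \<le> e \<and> y \<le> b \<longrightarrow> d y = 0"
    and x: "x \<in> {a..b}"
  shows "d x = 0"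
proof (rule ccontr)
  assume "d x \<noteq> 0"
  define S where "S = {y \<in> {a..b}. d y \<noteq> 0}"
  have S: "x \<in> S" "bdd_below S" using x \<open>d x \<noteq> 0\<close> by (auto simp: S_def intro!: bdd_belowI[of _ a])
  define x0 where "x0 = Inf S"
  have x0: "a \<le> x0" "x0 \<le> x"
    using S unfolding x0_def by (auto intro!: cInf_greatest cInf_lower simp: S_def)
  have zero: "d y = 0" if "a \<le> y" "y < x0" for y
  proof -
    have "y \<notin> S" using that cInf_lower[OF _ S(2), of y] by (auto simp: x0_def)
    then show ?thesis using that x x0 by (auto simp: S_def)
  qed
  have "d x0 = 0"
  proof (cases "a = x0")
    case False
    then have "a < x0" using x0 by simp
    have "continuous_on {a..x0} d" using assms(1) by (rule continuous_on_subset) (use x x0 in auto)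
    then show ?thesis
      using zero \<open>a < x0\<close> continuous_constant_on_closure[of "{a<..<x0}" d 0 x0] by auto
  qed (use assms in simp)
  moreover have "x0 < b" using \<open>d x0 = 0\<close> \<open>d x \<noteq> 0\<close> x x0 by (cases "x0 = x") auto
  ultimately obtain e where e: "x0 < e" "\<And>y. x0 \<le> y \<Longrightarrow> y \<le> e \<Longrightarrow> y \<le> b \<Longrightarrow> d y = 0"
    using step[of x0] x0 by blast
  have "e \<le> Inf S"
  proof (rule cInf_greatest)
    fix y assume "y \<in> S"
    then have "\<not> (y \<le> e)" using e(2)[of y] zero[of y] by (force simp: S_def)
    then show "e \<le> y" by simp
  qed (use S in auto)
  then show False using e(1) by (simp add: x0_def)
qed

text \<open>In terms of \<open>z t = exp (- K * t) * y t\<close> with \<open>K > 2 * \<bar>L\<bar>\<close> the integral operator is a contraction for the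
  supremum norm on the whole interval, so a single application of Banach's fixed point theorem
  suffices.  Functions on \<open>[0,1]\<close> are extended to the line by constants, in order to work in the
  Banach space of bounded continuous functions.\<close>

lemma picard_lindeloef:
  fixes F :: "real \<Rightarrow> real \<Rightarrow> real"
  assumes cont: "\<And>y. continuous_on {0..1} y \<Longrightarrow> continuous_on {0..1} (\<lambda>t. F t (y t))"
    and lip: "\<And>t x y. t \<in> {0..1} \<Longrightarrow> \<bar>F t x - F t y\<bar> \<le> L * \<bar>x - y\<bar>"
  shows "\<exists>y. y 0 = y0 \<and> (\<forall>t \<in> {0..1}. (y has_real_derivative F t (y t)) (at t within {0..1}))"
proof -
  define K where "K = 2 * \<bar>L\<bar> + 1"
  have K: "0 < K" "\<bar>L\<bar> / K \<le> 1 / 2" by (auto simp: K_def field_simps)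
  define I where "I z s = integral {0..s} (\<lambda>t. F t (exp (K * t) * z t))" for z s
  define G where "G z s = exp (- K * s) * (y0 + I z s)" for z s
  \<comment> \<open>the retraction of the line to \<open>[0,1]\<close>\<close>
  define c :: "real \<Rightarrow> real" where "c x = max 0 (min x 1)" for x
  have c: "c x \<in> {0..1}" for x by (auto simp: c_def)
  have contF: "continuous_on {0..1} (\<lambda>t. F t (exp (K * t) * apply_bcontfun z t))" for z
    by (intro cont continuous_intros) auto
  have I_deriv: "(I (apply_bcontfun z) has_real_derivative F s (exp (K * s) * apply_bcontfun z s))
      (at s within {0..1})" if "s \<in> {0..1}" for z s
    unfolding I_def by (rule integral_has_real_derivative[OF contF that])
  have "continuous_on {0..1} (I (apply_bcontfun z))" for z
    by (rule DERIV_continuous_on[OF I_deriv])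
  then have contG: "continuous_on {0..1} (G (apply_bcontfun z))" for z
    unfolding G_def by (intro continuous_intros)
  have inb: "(\<lambda>x. G (apply_bcontfun z) (c x)) \<in> bcontfun" for z
  proof -
    have "bounded (G (apply_bcontfun z) ` {0..1})"
      using contG by (intro compact_imp_bounded compact_continuous_image) auto
    then obtain B where "\<forall>s \<in> {0..1}. norm (G (apply_bcontfun z) s) \<le> B"
      by (auto simp: bounded_iff)
    moreover have "continuous_on UNIV (\<lambda>x. G (apply_bcontfun z) (c x))"
      using c unfolding c_def
      by (intro continuous_on_compose2[OF contG[of z]] continuous_intros) auto
    ultimately show ?thesis using c by (intro bcontfun_normI) auto
  qed
  define T where "T z = Bcontfun (\<lambda>x. G (apply_bcontfun z) (c x))" for z
  have T: "apply_bcontfun (T z) x = G (apply_bcontfun z) (c x)" for z x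
    unfolding T_def by (simp add: Bcontfun_inverse[OF inb])
  have "dist (T z) (T w) \<le> 1 / 2 * dist z w" for z w
  proof (rule dist_bound)
    fix x
    define s where "s = c x"
    have s: "s \<in> {0..1}" using c by (simp add: s_def)
    define d where "d = dist z w"
    let ?f = "\<lambda>z t. F t (exp (K * t) * apply_bcontfun z t)"
    have int: "?f z integrable_on {0..s}" for z
      by (rule integrable_continuous_interval, rule continuous_on_subset[OF contF]) (use s in auto)
    have E: "((\<lambda>t. \<bar>L\<bar> * d * exp (K * t)) has_integral
        (\<bar>L\<bar> * d * exp (K * s) / K - \<bar>L\<bar> * d * exp (K * 0) / K)) {0..s}"
      using s K(1) by (intro fundamental_theorem_of_calculus)
        (auto intro!: derivative_eq_intros simp flip: has_real_derivative_iff_has_vector_derivative)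
    have "\<bar>I (apply_bcontfun z) s - I (apply_bcontfun w) s\<bar> =
        norm (integral {0..s} (\<lambda>t. ?f z t - ?f w t))"
      unfolding I_def using Henstock_Kurzweil_Integration.integral_diff[OF int[of z] int[of w]] by simp
    also have "\<dots> \<le> integral {0..s} (\<lambda>t. \<bar>L\<bar> * d * exp (K * t))"
    proof (rule integral_norm_bound_integral)
      fix t assume t: "t \<in> {0..s}"
      have "norm (?f z t - ?f w t) \<le>
          L * \<bar>exp (K * t) * apply_bcontfun z t - exp (K * t) * apply_bcontfun w t\<bar>"
        using lip[of t] s t by auto
      also have "\<dots> \<le> \<bar>L\<bar> * \<bar>exp (K * t) * apply_bcontfun z t - exp (K * t) * apply_bcontfun w t\<bar>"
        by (intro mult_right_mono) auto
      also have "\<bar>exp (K * t) * apply_bcontfun z t - exp (K * t) * apply_bcontfun w t\<bar> =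
          exp (K * t) * dist (apply_bcontfun z t) (apply_bcontfun w t)"
        by (simp add: dist_real_def abs_mult flip: right_diff_distrib)
      also have "\<bar>L\<bar> * \<dots> \<le> \<bar>L\<bar> * (exp (K * t) * d)"
        unfolding d_def by (intro mult_left_mono dist_bounded) auto
      finally show "norm (?f z t - ?f w t) \<le> \<bar>L\<bar> * d * exp (K * t)"
        by (simp add: mult_ac)
    qed (use int E in \<open>auto intro: integrable_diff\<close>)
    also have "\<dots> = \<bar>L\<bar> * d * exp (K * s) / K - \<bar>L\<bar> * d * exp (K * 0) / K"
      by (rule integral_unique[OF E])
    also have "\<dots> = \<bar>L\<bar> / K * d * (exp (K * s) - 1)"
      by (simp add: right_diff_distrib diff_divide_distrib mult_ac)
    finally have *: "\<bar>I (apply_bcontfun z) s - I (apply_bcontfun w) s\<bar> \<le>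
      \<bar>L\<bar> / K * d * (exp (K * s) - 1)" .
    have "dist (apply_bcontfun (T z) x) (apply_bcontfun (T w) x) =
        exp (- K * s) * \<bar>I (apply_bcontfun z) s - I (apply_bcontfun w) s\<bar>"
      unfolding T G_def dist_real_def by (simp add: abs_mult s_def flip: right_diff_distrib)
    also have "\<dots> \<le> exp (- K * s) * (\<bar>L\<bar> / K * d * (exp (K * s) - 1))"
      by (rule mult_left_mono[OF *]) simp
    also have "\<dots> = \<bar>L\<bar> / K * d * (1 - exp (- K * s))"
    proof -
      have "exp (- K * s) * (c * (exp (K * s) - 1)) = c * (1 - exp (- K * s))" for c
        by (simp add: algebra_simps flip: exp_add)
      then show ?thesis .
    qed
    also have "\<dots> \<le> \<bar>L\<bar> / K * d * 1"
      using K by (intro mult_left_mono) (auto simp: d_def)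
    also have "\<dots> \<le> 1 / 2 * d"
      using K(2) by (simp only: mult_1_right, intro mult_right_mono) (auto simp: d_def)
    finally show "dist (apply_bcontfun (T z) x) (apply_bcontfun (T w) x) \<le> 1 / 2 * dist z w"
      by (simp add: d_def)
  qed
  then obtain z where z: "T z = z"
    using banach_fix_type[of "1 / 2" T] by auto
  define y where "y t = exp (K * t) * apply_bcontfun z t" for t
  have zt: "apply_bcontfun z t = G (apply_bcontfun z) t" if "t \<in> {0..1}" for t
    using T[of z t] z that by (simp add: c_def)
  have y: "y t = y0 + I (apply_bcontfun z) t" if "t \<in> {0..1}" for t
    unfolding y_def zt[OF that] G_def by (simp flip: exp_add mult.assoc)
  show ?thesis
  proof (intro exI[of _ y] conjI ballI)
    show "y 0 = y0" using y[of 0] by (simp add: I_def)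
    fix t :: real assume t: "t \<in> {0..1}"
    have "((\<lambda>t. y0 + I (apply_bcontfun z) t) has_real_derivative F t (y t)) (at t within {0..1})"
      using I_deriv[OF t, of z] unfolding y_def by (auto intro!: derivative_eq_intros)
    then show "(y has_real_derivative F t (y t)) (at t within {0..1})"
      by (rule has_field_derivative_transform_within[where d = 1]) (use t in \<open>auto simp: y\<close>)
  qed
qed

section \<open>Uniqueness for planar half-linear systems\<close>

text \<open>The first-order form of a half-linear equation, with \<open>v\<close> in the role of \<open>phi p u'\<close> and with \<open>q\<close>
  conjugate to \<open>p\<close>.  Separate coefficients for the positive and the negative part make the class of these
  systems closed under \<open>(u, v) \<mapsto> (- u, - v)\<close>.\<close>

definition planar_solution where
  "planar_solution p q g h a b u v \<longleftrightarrow> continuous_on {a..b} u \<and> continuous_on {a..b} v \<and>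
    (\<forall>x \<in> {a<..<b}. (u has_real_derivative phi q (v x)) (at x) \<and>
       (v has_real_derivative g x * phi p (pos_part (u x)) + h x * phi p (neg_part (u x))) (at x))"

text \<open>Two solutions, numbered 0 and 1, of the system \<open>U' = f \<phi>\<^sub>m(V)\<close>, \<open>V' = G(x, U)\<close> with \<open>G\<close> positively homogeneous
  of degree \<open>n - 1\<close> in \<open>U\<close>.  Since \<open>(m - 1) (n - 1) = 1\<close>, the quotient \<open>y = U V\<^sup>1\<^sup>-\<^sup>m\<close> is invariant
  under the scalings of the system, and therefore satisfies an equation of its own,
  \<open>y' = f + (1 - m) y G(x, y)\<close>.  Here \<open>y G(x, y)\<close> consists of \<open>n\<close>-th powers of the positive and negative part of
  \<open>y\<close>, hence is Lipschitz for bounded \<open>y\<close> although \<open>G\<close> alone need not be.  So both solutions have the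
  same quotient, and \<open>(ln V)' = G(x, y)\<close> shows that they have the same \<open>V\<close>.  Leaving \<open>m\<close>, \<open>n\<close>, \<open>f\<close> and \<open>G\<close> general
  permits the roles of \<open>u\<close> and \<open>v\<close> to be exchanged.\<close>

lemma chart_unique:
  fixes U V :: "nat \<Rightarrow> real \<Rightarrow> real"
  assumes mn: "1 < m" "1 < n" "(m - 1) * (n - 1) = 1" and ab: "a \<le> b"
    and bnd: "\<And>x. a < x \<Longrightarrow> x < b \<Longrightarrow> \<bar>g x\<bar> \<le> B \<and> \<bar>h x\<bar> \<le> B"
    and cont: "\<And>i. continuous_on {a..b} (U i)" "\<And>i. continuous_on {a..b} (V i)"
    and pos: "\<And>i x. x \<in> {a..b} \<Longrightarrow> 0 < V i x"
    and U': "\<And>i x. a < x \<Longrightarrow> x < b \<Longrightarrow> (U i has_real_derivative f x * phi m (V i x)) (at x)"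
    and V': "\<And>i x. a < x \<Longrightarrow> x < b \<Longrightarrow>
      (V i has_real_derivative g x * phi n (pos_part (U i x)) + h x * phi n (neg_part (U i x))) (at x)"
    and init: "U 0 a = U 1 a" "V 0 a = V 1 a"
  shows "U 0 b = U 1 b \<and> V 0 b = V 1 b"
proof -
  define y where "y i x = U i x * V i x powr (1 - m)" for i x
  define G where "G x s = g x * phi n (pos_part s) + h x * phi n (neg_part s)" for x s
  have U_eq: "U i x = y i x * V i x powr (m - 1)" if "x \<in> {a..b}" for i x
    using pos[OF that, of i] by (simp add: y_def powr_add[symmetric])
  \<comment> \<open>homogeneity: the factor is \<open>(V i x powr (m - 1)) powr (n - 1) = V i x\<close>\<close>
  have G_eq: "G x (U i x) = V i x * G x (y i x)" if "x \<in> {a..b}" for i x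
  proof -
    have "0 < V i x" using pos that by auto
    moreover from this have "phi n (V i x powr (m - 1)) = V i x"
      using phi_phi_conjugate[of n m "V i x"] mn by (simp add: phi_pos mult.commute)
    moreover have "pos_part (y i x * V i x powr (m - 1)) = pos_part (y i x) * V i x powr (m - 1)"
      "neg_part (y i x * V i x powr (m - 1)) = neg_part (y i x) * V i x powr (m - 1)"
      using \<open>0 < V i x\<close> by (auto intro: pos_part_mult neg_part_mult)
    ultimately show ?thesis
      unfolding U_eq[OF that] G_def by (simp only: phi_mult) (simp only: algebra_simps)
  qed
  have contV: "continuous_on {a..b} (\<lambda>x. V i x powr r)" for i r
    using pos cont(2)[of i] by (intro continuous_intros) (auto simp: less_imp_neq[symmetric])
  have conty: "continuous_on {a..b} (y i)" for i
    unfolding y_def by (intro continuous_on_mult cont(1) contV)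
  have y': "(y i has_real_derivative f x + (1 - m) * (y i x * G x (y i x))) (at x)"
    if x: "a < x" "x < b" for i x
  proof -
    have V0: "0 < V i x" using pos x by auto
    have "(V i has_real_derivative G x (U i x)) (at x)" using V'[OF x] by (simp add: G_def)
    then have "((\<lambda>x. V i x powr (1 - m)) has_real_derivative
        (1 - m) * V i x powr (1 - m - 1) * G x (U i x)) (at x)"
      using DERIV_fun_powr[of "V i" _ x "1 - m"] V0 by simp
    then have "(y i has_real_derivative f x * phi m (V i x) * V i x powr (1 - m) +
        (1 - m) * V i x powr (1 - m - 1) * G x (U i x) * U i x) (at x)"
      unfolding y_def using U'[OF x, of i] by (rule DERIV_mult[rotated])
    moreover have "phi m (V i x) * V i x powr (1 - m) = 1"
      using V0 by (simp add: phi_pos powr_add[symmetric])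
    moreover have "V i x powr (1 - m - 1) * G x (U i x) * U i x = y i x * G x (y i x)"
      using V0 x powr_add[of "V i x" "- m" 1] by (simp add: G_eq y_def[of i x])
    ultimately show ?thesis by (simp add: mult.assoc)
  qed
  have "\<exists>K. \<forall>x \<in> {a..b}. \<bar>y i x\<bar> \<le> K" for i
    using compact_imp_bounded[OF compact_continuous_image[OF conty[of i] compact_Icc]]
    by (auto simp: bounded_iff)
  then obtain K0 K1 where "\<And>x. x \<in> {a..b} \<Longrightarrow> \<bar>y 0 x\<bar> \<le> K0" "\<And>x. x \<in> {a..b} \<Longrightarrow> \<bar>y 1 x\<bar> \<le> K1"
    by meson
  then have K: "\<bar>y 0 x\<bar> \<le> max K0 K1" "\<bar>y 1 x\<bar> \<le> max K0 K1" if "x \<in> {a..b}" for x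
    using that by (auto simp: le_max_iff_disj)
  define P where "P = n * max K0 K1 powr (n - 1)"
  have "0 \<le> P" using mn by (simp add: P_def)
  have lip: "\<bar>y 0 x * G x (y 0 x) - y 1 x * G x (y 1 x)\<bar> \<le> 2 * B * P * \<bar>y 0 x - y 1 x\<bar>"
    if x: "a < x" "x < b" for x
  proof -
    have B: "\<bar>g x\<bar> \<le> B" "\<bar>h x\<bar> \<le> B" "0 \<le> B" using bnd[OF x] by auto
    have le: "\<bar>y 0 x\<bar> \<le> max K0 K1" "\<bar>y 1 x\<bar> \<le> max K0 K1" using K x by auto
    have 1: "\<bar>pos_part (y 0 x) powr n - pos_part (y 1 x) powr n\<bar> \<le> P * \<bar>y 0 x - y 1 x\<bar>"
      unfolding P_def using le pos_part_bounds[of "y 0 x"] pos_part_bounds[of "y 1 x"] mn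
      by (intro order_trans[OF powr_lipschitz mult_left_mono[OF pos_part_lipschitz]]) auto
    have 2: "\<bar>neg_part (y 0 x) powr n - neg_part (y 1 x) powr n\<bar> \<le> P * \<bar>y 0 x - y 1 x\<bar>"
      unfolding P_def using le neg_part_bounds[of "y 0 x"] neg_part_bounds[of "y 1 x"] mn
      by (intro order_trans[OF powr_lipschitz mult_left_mono[OF neg_part_lipschitz]]) auto
    have yG: "s * G x s = g x * pos_part s powr n - h x * neg_part s powr n" for s
      by (simp add: G_def distrib_left mult_phi_pos_part mult_phi_neg_part mult.left_commute[of s])
    have "\<bar>y 0 x * G x (y 0 x) - y 1 x * G x (y 1 x)\<bar> =
        \<bar>g x * (pos_part (y 0 x) powr n - pos_part (y 1 x) powr n) -
          h x * (neg_part (y 0 x) powr n - neg_part (y 1 x) powr n)\<bar>"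
      unfolding yG by (simp add: algebra_simps)
    also have "\<dots> \<le> \<bar>g x\<bar> * \<bar>pos_part (y 0 x) powr n - pos_part (y 1 x) powr n\<bar> +
          \<bar>h x\<bar> * \<bar>neg_part (y 0 x) powr n - neg_part (y 1 x) powr n\<bar>"
      unfolding abs_mult[symmetric] by (rule abs_triangle_ineq4)
    also have "\<dots> \<le> B * (P * \<bar>y 0 x - y 1 x\<bar>) + B * (P * \<bar>y 0 x - y 1 x\<bar>)"
      using B 1 2 by (intro add_mono mult_mono) auto
    finally show ?thesis by (simp add: mult_ac)
  qed
  define L where "L = (m - 1) * (2 * B * P)"
  have diff: "\<bar>f x + (1 - m) * (y 0 x * G x (y 0 x)) - (f x + (1 - m) * (y 1 x * G x (y 1 x)))\<bar> \<le>
      L * \<bar>y 0 x - y 1 x\<bar>" if x: "a < x" "x < b" for x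
  proof -
    have "\<bar>f x + (1 - m) * (y 0 x * G x (y 0 x)) - (f x + (1 - m) * (y 1 x * G x (y 1 x)))\<bar> =
        (m - 1) * \<bar>y 0 x * G x (y 0 x) - y 1 x * G x (y 1 x)\<bar>"
      using mn(1) abs_mult[of "1 - m" "y 0 x * G x (y 0 x) - y 1 x * G x (y 1 x)"]
      by (simp add: algebra_simps)
    also have "\<dots> \<le> (m - 1) * (2 * B * P * \<bar>y 0 x - y 1 x\<bar>)"
      using lip[OF x] mn(1) by (intro mult_left_mono) auto
    finally show ?thesis by (simp add: L_def mult.assoc)
  qed
  have ya: "y 0 a = y 1 a" using init by (simp add: y_def)
  have y_eq: "y 0 x = y 1 x" if x: "x \<in> {a..b}" for x
  proof (rule antisym)
    have c: "continuous_on {a..x} (y i)" for i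
      using conty by (rule continuous_on_subset) (use x in auto)
    show "y 0 x \<le> y 1 x"
    proof (rule comparison[where L = L, OF _ c c])
      fix t assume t: "a < t" "t < x"
      then show "\<exists>y' z'. (y 0 has_real_derivative y') (at t) \<and> (y 1 has_real_derivative z') (at t) \<and>
        y' - z' \<le> L * \<bar>y 0 t - y 1 t\<bar>"
        using y'[of t 0] y'[of t 1] diff[of t] x by (intro exI conjI) auto
    qed (use x ya in auto)
    show "y 1 x \<le> y 0 x"
    proof (rule comparison[where L = L, OF _ c c])
      fix t assume t: "a < t" "t < x"
      then show "\<exists>y' z'. (y 1 has_real_derivative y') (at t) \<and> (y 0 has_real_derivative z') (at t) \<and>
        y' - z' \<le> L * \<bar>y 1 t - y 0 t\<bar>"
        using y'[of t 0] y'[of t 1] diff[of t] x by (intro exI conjI) (auto simp: abs_minus_commute)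
    qed (use x ya in auto)
  qed
  have "ln (V 0 b) - ln (V 1 b) = ln (V 0 a) - ln (V 1 a)"
  proof (cases "a = b")
    case False
    show ?thesis
    proof (rule DERIV_isconst_end[of a b "\<lambda>x. ln (V 0 x) - ln (V 1 x)"])
      show "continuous_on {a..b} (\<lambda>x. ln (V 0 x) - ln (V 1 x))"
        using pos cont(2) by (intro continuous_intros) (auto simp: less_imp_neq[symmetric])
      fix x assume x: "a < x" "x < b"
      have "((\<lambda>x. ln (V i x)) has_real_derivative G x (y 1 x)) (at x)" if "i \<in> {0, 1}" for i
      proof -
        have "0 < V i x" using pos x by auto
        then have "((\<lambda>x. ln (V i x)) has_real_derivative G x (U i x) / V i x) (at x)"
          using V'[OF x, of i] by (auto simp: G_def intro!: derivative_eq_intros)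
        also have "G x (U i x) / V i x = G x (y 1 x)"
          using \<open>0 < V i x\<close> G_eq[of x i] y_eq[of x] x that by auto
        finally show ?thesis .
      qed
      from DERIV_diff[OF this[of 0] this[of 1]]
      show "((\<lambda>x. ln (V 0 x) - ln (V 1 x)) has_real_derivative 0) (at x)" by simp
    qed (use ab False in auto)
  qed simp
  then have "ln (V 0 b) = ln (V 1 b)" by (simp add: init)
  moreover have b: "b \<in> {a..b}" using ab by simp
  ultimately have "V 0 b = V 1 b" using pos[OF b] ln_inj_iff by blast
  then show ?thesis unfolding U_eq[OF b] y_eq[OF b] by simp
qed

lemma stays_positive_to_the_right:
  fixes f :: "real \<Rightarrow> real"
  assumes "continuous_on {a..b} f" "a \<le> x" "x < b" "0 < f x"
  shows "\<exists>e > x. e \<le> b \<and> (\<forall>y \<in> {x..e}. 0 < f y)"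
proof -
  have "(f \<longlongrightarrow> f x) (at x within {a..b})"
    using assms by (auto simp: continuous_on_def)
  then have "\<forall>\<^sub>F y in at x within {a..b}. 0 < f y"
    using assms(4) by (rule order_tendstoD)
  then obtain d where d: "0 < d" "\<And>y. y \<in> {a..b} \<Longrightarrow> y \<noteq> x \<Longrightarrow> dist y x < d \<Longrightarrow> 0 < f y"
    by (auto simp: eventually_at)
  have "0 < f y" if "x \<le> y" "y \<le> min b (x + d / 2)" for y
    using d that assms by (cases "y = x") (auto simp: dist_real_def)
  then show ?thesis
    using d(1) assms(3) by (intro exI[of _ "min b (x + d / 2)"]) auto
qed

lemma planar_solution_subset:
  "planar_solution p q g h a b u v \<Longrightarrow> a \<le> c \<Longrightarrow> d \<le> b \<Longrightarrow> planar_solution p q g h c d u v"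
  by (auto simp: planar_solution_def intro: continuous_on_subset)

lemma planar_solution_minus:
  "planar_solution p q g h a b u v \<Longrightarrow>
    planar_solution p q (\<lambda>x. - h x) (\<lambda>x. - g x) a b (\<lambda>x. - u x) (\<lambda>x. - v x)"
  unfolding planar_solution_def
  by (auto intro!: continuous_intros derivative_eq_intros)

context
  fixes p q a b B :: real and g h :: "real \<Rightarrow> real"
  assumes pq: "1 < p" "1 < q" "(p - 1) * (q - 1) = 1"
    and bnd: "\<And>x. a < x \<Longrightarrow> x < b \<Longrightarrow> \<bar>g x\<bar> \<le> B \<and> \<bar>h x\<bar> \<le> B"
begin

lemma planar_unique_if_v_pos:
  assumes sol: "planar_solution p q g h a b u1 v1" "planar_solution p q g h a b u2 v2"
    and ab: "a \<le> b" and pos: "\<And>x. x \<in> {a..b} \<Longrightarrow> 0 < v1 x \<and> 0 < v2 x"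
    and init: "u1 a = u2 a" "v1 a = v2 a"
  shows "u1 b = u2 b \<and> v1 b = v2 b"
  using chart_unique[of q p a b g B h "case_nat u1 (\<lambda>_. u2)" "case_nat v1 (\<lambda>_. v2)" "\<lambda>_. 1"]
    pq bnd sol ab pos init
  by (auto simp: planar_solution_def mult.commute split: nat.splits)

text \<open>The quotient is now \<open>v / \<phi>\<^sub>p(u)\<close>: as \<open>u > 0\<close>, the equation for \<open>v\<close> is the one with the single
  coefficient \<open>g\<close>, and the equation for \<open>u\<close> is \<open>u' = \<phi>\<^sub>q(v\<^sup>+) - \<phi>\<^sub>q(v\<^sup>-)\<close>.\<close>

lemma planar_unique_if_u_pos:
  assumes sol: "planar_solution p q g h a b u1 v1" "planar_solution p q g h a b u2 v2"
    and ab: "a \<le> b" and pos: "\<And>x. x \<in> {a..b} \<Longrightarrow> 0 < u1 x \<and> 0 < u2 x"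
    and init: "u1 a = u2 a" "v1 a = v2 a"
  shows "u1 b = u2 b \<and> v1 b = v2 b"
proof -
  have "case_nat v1 (\<lambda>_. v2) 0 b = case_nat v1 (\<lambda>_. v2) 1 b \<and>
      case_nat u1 (\<lambda>_. u2) 0 b = case_nat u1 (\<lambda>_. u2) 1 b"
  proof (rule chart_unique[where m = p and n = q and a = a and f = g and
        g = "\<lambda>_. 1" and h = "\<lambda>_. - 1" and B = 1])
    fix i x assume x: "a < x" "x < b"
    have u: "0 < case_nat u1 (\<lambda>_. u2) i x" using pos[of x] x by (auto split: nat.splits)
    then have "pos_part (case_nat u1 (\<lambda>_. u2) i x) = case_nat u1 (\<lambda>_. u2) i x"
      "neg_part (case_nat u1 (\<lambda>_. u2) i x) = 0"
      by (auto simp: pos_part_def neg_part_def)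
    then show "(case_nat v1 (\<lambda>_. v2) i has_real_derivative
        g x * phi p (case_nat u1 (\<lambda>_. u2) i x)) (at x)"
      using sol x by (cases i) (auto simp: planar_solution_def dest!: bspec[of _ _ x])
    show "(case_nat u1 (\<lambda>_. u2) i has_real_derivative
        1 * phi q (pos_part (case_nat v1 (\<lambda>_. v2) i x)) +
        - 1 * phi q (neg_part (case_nat v1 (\<lambda>_. v2) i x))) (at x)"
      using sol x phi_decompose[of q "case_nat v1 (\<lambda>_. v2) i x"]
      by (cases i) (auto simp: planar_solution_def dest!: bspec[of _ _ x])
  qed (use pq sol ab pos init in \<open>auto simp: planar_solution_def split: nat.splits\<close>)
  then show ?thesis by simp
qed

end

text \<open>Away from the origin one of \<open>u\<close>, \<open>v\<close>, \<open>- u\<close>, \<open>- v\<close> is positive, and stays so for a while.\<close>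

lemma planar_unique_locally:
  assumes pq: "1 < p" "1 < q" "(p - 1) * (q - 1) = 1"
    and bnd: "\<And>x. a < x \<Longrightarrow> x < b \<Longrightarrow> \<bar>g x\<bar> \<le> B \<and> \<bar>h x\<bar> \<le> B"
    and sol: "planar_solution p q g h a b u1 v1" "planar_solution p q g h a b u2 v2"
    and x: "a \<le> x" "x < b"
    and init: "u1 x = u2 x" "v1 x = v2 x" and nz: "(u1 x, v1 x) \<noteq> (0, 0)"
  shows "\<exists>e > x. \<forall>y. x \<le> y \<and> y \<le> e \<and> y \<le> b \<longrightarrow> u1 y = u2 y \<and> v1 y = v2 y"
proof -
  have main: "\<exists>e > x. \<forall>y. x \<le> y \<and> y \<le> e \<and> y \<le> b \<longrightarrow> u1 y = u2 y \<and> v1 y = v2 y"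
    if pos: "0 < u1 x \<or> 0 < v1 x"
      and bnd: "\<And>x. a < x \<Longrightarrow> x < b \<Longrightarrow> \<bar>g x\<bar> \<le> B \<and> \<bar>h x\<bar> \<le> B"
      and sol: "planar_solution p q g h a b u1 v1" "planar_solution p q g h a b u2 v2"
      and init: "u1 x = u2 x" "v1 x = v2 x" for g h u1 v1 u2 v2
    using pos
  proof
    assume "0 < u1 x"
    then have "\<exists>e > x. e \<le> b \<and> (\<forall>y \<in> {x..e}. 0 < min (u1 y) (u2 y))"
      using sol x init
      by (intro stays_positive_to_the_right[of a b]) (auto simp: planar_solution_def intro!: continuous_intros)
    then obtain e where e: "x < e" "e \<le> b" "\<forall>y \<in> {x..e}. 0 < u1 y \<and> 0 < u2 y" by auto
    have "u1 y = u2 y \<and> v1 y = v2 y" if y: "x \<le> y" "y \<le> e" for y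
      by (rule planar_unique_if_u_pos[OF pq _ planar_solution_subset[OF sol(1)]
            planar_solution_subset[OF sol(2)], of x y B])
        (use y e x bnd init in auto)
    then show ?thesis using e by auto
  next
    assume "0 < v1 x"
    then have "\<exists>e > x. e \<le> b \<and> (\<forall>y \<in> {x..e}. 0 < min (v1 y) (v2 y))"
      using sol x init
      by (intro stays_positive_to_the_right[of a b]) (auto simp: planar_solution_def intro!: continuous_intros)
    then obtain e where e: "x < e" "e \<le> b" "\<forall>y \<in> {x..e}. 0 < v1 y \<and> 0 < v2 y" by auto
    have "u1 y = u2 y \<and> v1 y = v2 y" if y: "x \<le> y" "y \<le> e" for y
      by (rule planar_unique_if_v_pos[OF pq _ planar_solution_subset[OF sol(1)]
            planar_solution_subset[OF sol(2)], of x y B])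
        (use y e x bnd init in auto)
    then show ?thesis using e by auto
  qed
  show ?thesis
  proof (cases "0 < u1 x \<or> 0 < v1 x")
    case True
    then show ?thesis using main[OF _ bnd sol init] by blast
  next
    case False
    then have "0 < - u1 x \<or> 0 < - v1 x" using nz by auto
    then show ?thesis
      using main[OF _ _ planar_solution_minus[OF sol(1)] planar_solution_minus[OF sol(2)]] bnd init
      by auto
  qed
qed

lemma planar_unique:
  assumes pq: "1 < p" "1 < q" "(p - 1) * (q - 1) = 1"
    and bnd: "\<And>x. a < x \<Longrightarrow> x < b \<Longrightarrow> \<bar>g x\<bar> \<le> B \<and> \<bar>h x\<bar> \<le> B"
    and sol: "planar_solution p q g h a b u1 v1" "planar_solution p q g h a b u2 v2"
    and init: "u1 a = u2 a" "v1 a = v2 a"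
    and nz: "\<And>x. x \<in> {a..b} \<Longrightarrow> (u1 x, v1 x) \<noteq> (0, 0)"
    and x: "x \<in> {a..b}"
  shows "u1 x = u2 x \<and> v1 x = v2 x"
proof -
  have "\<bar>u1 x - u2 x\<bar> + \<bar>v1 x - v2 x\<bar> = 0"
  proof (rule vanishes_if_zero_propagates[OF _ _ _ x])
    show "continuous_on {a..b} (\<lambda>x. \<bar>u1 x - u2 x\<bar> + \<bar>v1 x - v2 x\<bar>)"
      using sol by (auto simp: planar_solution_def intro!: continuous_intros)
    have iff: "\<bar>u1 y - u2 y\<bar> + \<bar>v1 y - v2 y\<bar> = 0 \<longleftrightarrow> u1 y = u2 y \<and> v1 y = v2 y" for y
      by auto
    fix x assume "a \<le> x" "x < b" "\<bar>u1 x - u2 x\<bar> + \<bar>v1 x - v2 x\<bar> = 0"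
    then show "\<exists>e > x. \<forall>y. x \<le> y \<and> y \<le> e \<and> y \<le> b \<longrightarrow> \<bar>u1 y - u2 y\<bar> + \<bar>v1 y - v2 y\<bar> = 0"
      unfolding iff using planar_unique_locally[OF pq bnd sol, of x] nz[of x] by auto
  qed (use init in auto)
  then show ?thesis by auto
qed

text \<open>A crude form of Young's inequality: replace the smaller of \<open>\<bar>s\<bar>\<close> and \<open>\<bar>t\<bar>\<close> by the larger one.\<close>

lemma powr_mult_powr_le:
  fixes s t :: real
  assumes "0 < \<alpha>" "0 < \<beta>"
  shows "\<bar>s\<bar> powr \<alpha> * \<bar>t\<bar> powr \<beta> \<le> \<bar>s\<bar> powr (\<alpha> + \<beta>) + \<bar>t\<bar> powr (\<alpha> + \<beta>)"
proof (cases "\<bar>s\<bar> \<le> \<bar>t\<bar>")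
  case True
  then have "\<bar>s\<bar> powr \<alpha> * \<bar>t\<bar> powr \<beta> \<le> \<bar>t\<bar> powr \<alpha> * \<bar>t\<bar> powr \<beta>"
    using assms by (intro mult_right_mono powr_mono2) auto
  then show ?thesis by (simp add: powr_add add_increasing)
next
  case False
  then have "\<bar>s\<bar> powr \<alpha> * \<bar>t\<bar> powr \<beta> \<le> \<bar>s\<bar> powr \<alpha> * \<bar>s\<bar> powr \<beta>"
    using assms by (intro mult_left_mono powr_mono2) auto
  then show ?thesis by (simp add: powr_add add_increasing2)
qed

lemma abs_phi_pos_neg_part_le:
  assumes "1 < p" "\<bar>g\<bar> \<le> B" "\<bar>h\<bar> \<le> B"
  shows "\<bar>g * phi p (pos_part s) + h * phi p (neg_part s)\<bar> \<le> B * \<bar>s\<bar> powr (p - 1)"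
proof (cases s "0::real" rule: linorder_cases)
  case less
  then show ?thesis
    using assms mult_right_mono[of "\<bar>h\<bar>" B "(- s) powr (p - 1)"]
    by (auto simp: pos_part_def neg_part_def phi_neg abs_mult)
next
  case greater
  then show ?thesis
    using assms mult_right_mono[of "\<bar>g\<bar>" B "s powr (p - 1)"]
    by (auto simp: pos_part_def neg_part_def phi_pos abs_mult)
qed (use assms in \<open>auto simp: pos_part_def neg_part_def\<close>)

text \<open>The energy \<open>H = \<bar>u\<bar>\<^sup>p + \<bar>v\<bar>\<^sup>q\<close> satisfies \<open>H' \<le> K H\<close>: every term of \<open>H'\<close> is bounded by a multiple of
  \<open>\<bar>u\<bar>\<^sup>p\<^sup>-\<^sup>1 \<bar>v\<bar>\<^sup>q\<^sup>-\<^sup>1\<close>, which is of the same degree as \<open>H\<close> under the scalings of the system.\<close>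

lemma planar_solution_zero:
  assumes pq: "1 < p" "1 < q" "(p - 1) * (q - 1) = 1"
    and bnd: "\<And>x. a < x \<Longrightarrow> x < b \<Longrightarrow> \<bar>g x\<bar> \<le> B \<and> \<bar>h x\<bar> \<le> B"
    and sol: "planar_solution p q g h a b u v" and zero: "u a = 0" "v a = 0"
    and x: "x \<in> {a..b}"
  shows "u x = 0 \<and> v x = 0"
proof (cases "a = x")
  case False
  define H where "H x = \<bar>u x\<bar> powr p + \<bar>v x\<bar> powr q" for x
  define K where "K = p + q * B"
  have ax: "a < x" using x False by simp
  have B: "0 \<le> B" using bnd[of "(a + b) / 2"] ax x by auto
  have pq': "p - 1 + (q - 1) * (p - 1) = p" "(p - 1) * q = p" using pq(3) by (auto simp: algebra_simps)
  have "H x \<le> H a * exp (K * (x - a))"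
  proof (rule gronwall)
    show "continuous_on {a..x} H"
      unfolding H_def using sol x pq
      by (intro continuous_intros continuous_on_powr') (auto simp: planar_solution_def intro: continuous_on_subset)
    fix t assume t: "a < t" "t < x"
    let ?G = "g t * phi p (pos_part (u t)) + h t * phi p (neg_part (u t))"
    have "(u has_real_derivative phi q (v t)) (at t)" "(v has_real_derivative ?G) (at t)"
      using sol t x by (auto simp: planar_solution_def)
    then have d: "(H has_real_derivative p * phi p (u t) * phi q (v t) + q * phi q (v t) * ?G) (at t)"
      unfolding H_def
      by (intro DERIV_add DERIV_chain2[OF abs_powr_has_real_derivative]) (use pq in auto)
    define W where "W = \<bar>u t\<bar> powr (p - 1)"
    have W: "0 \<le> W" "W powr q = \<bar>u t\<bar> powr p" by (auto simp: W_def powr_powr pq')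
    have aphi: "\<bar>phi r s\<bar> \<le> \<bar>s\<bar> powr (r - 1)" for r s :: real
      by (cases "s = 0") (auto simp: abs_phi)
    have "\<bar>phi q (v t)\<bar> * W \<le> \<bar>v t\<bar> powr (q - 1) * \<bar>W\<bar> powr 1"
      using W aphi by (auto intro!: mult_right_mono)
    also have "\<dots> \<le> \<bar>v t\<bar> powr (q - 1 + 1) + \<bar>W\<bar> powr (q - 1 + 1)"
      using pq by (intro powr_mult_powr_le) auto
    also have "\<dots> = H t" using W by (simp add: H_def)
    finally have *: "\<bar>phi q (v t)\<bar> * W \<le> H t" .
    have "p * phi p (u t) * phi q (v t) + q * phi q (v t) * ?G \<le>
        \<bar>p * phi p (u t) * phi q (v t)\<bar> + \<bar>q * phi q (v t) * ?G\<bar>" by linarith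
    also have "\<dots> = p * (\<bar>phi q (v t)\<bar> * \<bar>phi p (u t)\<bar>) + q * (\<bar>phi q (v t)\<bar> * \<bar>?G\<bar>)"
      using pq by (simp add: abs_mult)
    also have "\<dots> \<le> p * (\<bar>phi q (v t)\<bar> * W) + q * (\<bar>phi q (v t)\<bar> * (B * W))"
      using pq aphi[of p "u t"] abs_phi_pos_neg_part_le[of p "g t" B "h t" "u t"] bnd[of t] t x
      by (intro add_mono mult_left_mono) (auto simp: W_def)
    also have "\<dots> = K * (\<bar>phi q (v t)\<bar> * W)" by (simp add: K_def algebra_simps)
    also have "\<dots> \<le> K * H t" using * pq B by (intro mult_left_mono) (auto simp: K_def)
    finally show "\<exists>d. (H has_real_derivative d) (at t) \<and> d \<le> K * H t" using d by blast
  qed (use ax in simp)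
  also have "H a = 0" using zero by (simp add: H_def)
  finally have "\<bar>u x\<bar> powr p + \<bar>v x\<bar> powr q \<le> 0" by (simp add: H_def)
  moreover have "0 \<le> \<bar>u x\<bar> powr p" "0 \<le> \<bar>v x\<bar> powr q" by auto
  ultimately have "\<bar>u x\<bar> powr p = 0" "\<bar>v x\<bar> powr q = 0" by linarith+
  then show ?thesis by auto
qed (use zero in auto)

section \<open>Solutions of the boundary value problem\<close>

lemma deriv01_eq:
  assumes "x \<in> {0..1}" "(u has_real_derivative d) (at x within {0..1})"
  shows "deriv01 u x = d"
  using assms vector_derivative_within_cbox[of 0 1 x u d]
  by (simp add: deriv01_def has_real_derivative_iff_has_vector_derivative)

lemma has_real_derivative_deriv01:
  assumes "u differentiable_on {0..1}" "x \<in> {0..1}"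
  shows "(u has_real_derivative deriv01 u x) (at x within {0..1})"
  using assms vector_derivative_works[of u "at x within {0..1}"]
  by (simp add: deriv01_def has_real_derivative_iff_has_vector_derivative differentiable_on_def)

lemma E_I:
  assumes "\<And>x. x \<in> {0..1} \<Longrightarrow> (u has_real_derivative u' x) (at x within {0..1})"
    and "continuous_on {0..1} u'" "u 0 = 0" "u 1 = 0"
  shows "u \<in> E"
proof -
  have "u differentiable_on {0..1}"
    using assms(1) unfolding differentiable_on_def
    by (meson differentiable_def has_field_derivative_def)
  moreover have "continuous_on {0..1} (deriv01 u)"
    using assms(2) by (rule continuous_on_eq) (use deriv01_eq assms(1) in force)
  ultimately show ?thesis using assms by (simp add: E_def)
qed

text \<open>The right-hand side of the equation.  It is kept as a function of the spectral parameter, the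
  position and the value of the unknown, since below it is also evaluated at \<open>sin \<theta>\<close>.\<close>

definition rhs where
  "rhs p a \<alpha> \<beta> lam x s = lam * a x * phi p s + \<alpha> x * phi p (pos_part s) + \<beta> x * phi p (neg_part s)"

text \<open>This frees the notion of solution from \<open>deriv01\<close>: any function that is known to be the derivative will
  do, which is how solutions are transported and constructed below.\<close>

lemma solution_iff:
  "solution p a \<alpha> \<beta> lam u \<longleftrightarrow>
    (\<exists>u'. (\<forall>x \<in> {0..1}. (u has_real_derivative u' x) (at x within {0..1})) \<and>
      continuous_on {0..1} u' \<and> u 0 = 0 \<and> u 1 = 0 \<and>
      (\<forall>x \<in> {0<..<1}. ((\<lambda>t. phi p (u' t)) has_real_derivative - rhs p a \<alpha> \<beta> lam x (u x)) (at x)))"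
    (is "_ \<longleftrightarrow> (\<exists>u'. ?P u')")
proof
  assume "solution p a \<alpha> \<beta> lam u"
  then have "?P (deriv01 u)"
    by (auto simp: solution_def E_def rhs_def has_real_derivative_deriv01)
  then show "\<exists>u'. ?P u'" by blast
next
  assume "\<exists>u'. ?P u'"
  then obtain u' where u': "?P u'" by blast
  then have d: "deriv01 u x = u' x" if "x \<in> {0..1}" for x
    using that deriv01_eq by blast
  have "((\<lambda>t. phi p (deriv01 u t)) has_real_derivative - rhs p a \<alpha> \<beta> lam x (u x)) (at x)"
    if x: "x \<in> {0<..<1}" for x
  proof -
    have "\<forall>\<^sub>F t in nhds x. phi p (deriv01 u t) = phi p (u' t)"
      using x d eventually_nhds_in_open[of "{0<..<1}" x] by (auto elim!: eventually_mono)
    from DERIV_cong_ev[OF refl this refl] show ?thesis using u' x by blast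
  qed
  then show "solution p a \<alpha> \<beta> lam u"
    using u' E_I[of u u'] by (auto simp: solution_def rhs_def)
qed

lemma rhs_mult:
  "0 < c \<Longrightarrow> rhs p a \<alpha> \<beta> lam x (c * s) = phi p c * rhs p a \<alpha> \<beta> lam x s"
  using pos_part_mult[of c s] neg_part_mult[of c s]
  by (simp add: rhs_def phi_mult distrib_left mult.commute[of s c] mult.commute[of _ c] mult.left_commute)

lemma rhs_minus:
  "rhs p a (\<lambda>x. - \<beta> x) (\<lambda>x. - \<alpha> x) lam x (- s) = - rhs p a \<alpha> \<beta> lam x s"
  by (simp add: rhs_def)

lemma solution_mult:
  assumes sol: "solution p a \<alpha> \<beta> lam u" and c: "0 < c" and v: "\<And>x. x \<in> {0..1} \<Longrightarrow> v x = c * u x"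
  shows "solution p a \<alpha> \<beta> lam v"
proof -
  obtain u' where u': "\<And>x. x \<in> {0..1} \<Longrightarrow> (u has_real_derivative u' x) (at x within {0..1})"
    "continuous_on {0..1} u'" "u 0 = 0" "u 1 = 0"
    "\<And>x. x \<in> {0<..<1} \<Longrightarrow>
      ((\<lambda>t. phi p (u' t)) has_real_derivative - rhs p a \<alpha> \<beta> lam x (u x)) (at x)"
    using sol unfolding solution_iff by blast
  show ?thesis
    unfolding solution_iff
  proof (intro exI[of _ "\<lambda>x. c * u' x"] conjI ballI)
    fix x :: real assume x: "x \<in> {0..1}"
    show "(v has_real_derivative c * u' x) (at x within {0..1})"
      by (rule has_field_derivative_transform_within[where d = 1, OF DERIV_cmult[OF u'(1)[OF x]]])
        (use x v in auto)
  next
    fix x :: real assume x: "x \<in> {0<..<1}"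
    then have "v x = c * u x" using v by auto
    then have "- rhs p a \<alpha> \<beta> lam x (v x) = phi p c * - rhs p a \<alpha> \<beta> lam x (u x)"
      using rhs_mult[OF c] by simp
    then show "((\<lambda>t. phi p (c * u' t)) has_real_derivative - rhs p a \<alpha> \<beta> lam x (v x)) (at x)"
      using DERIV_cmult[OF u'(5)[OF x], of "phi p c"] by (simp add: phi_mult)
  qed (use u' v in \<open>auto intro: continuous_intros\<close>)
qed

lemma nontrivial_solution_mult:
  assumes "nontrivial_solution p a \<alpha> \<beta> lam u" "0 < c" "\<And>x. x \<in> {0..1} \<Longrightarrow> v x = c * u x"
  shows "nontrivial_solution p a \<alpha> \<beta> lam v"
  using assms solution_mult[of p a \<alpha> \<beta> lam u c v] by (auto simp: nontrivial_solution_def)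

text \<open>The reflection that exchanges the two families of half-eigenvalues.\<close>

lemma nontrivial_solution_minus:
  assumes "nontrivial_solution p a \<alpha> \<beta> lam u"
  shows "nontrivial_solution p a (\<lambda>x. - \<beta> x) (\<lambda>x. - \<alpha> x) lam (\<lambda>x. - u x)"
proof -
  obtain u' where u': "\<And>x. x \<in> {0..1} \<Longrightarrow> (u has_real_derivative u' x) (at x within {0..1})"
    "continuous_on {0..1} u'" "u 0 = 0" "u 1 = 0"
    "\<And>x. x \<in> {0<..<1} \<Longrightarrow>
      ((\<lambda>t. phi p (u' t)) has_real_derivative - rhs p a \<alpha> \<beta> lam x (u x)) (at x)"
    using assms unfolding nontrivial_solution_def solution_iff by blast
  have "solution p a (\<lambda>x. - \<beta> x) (\<lambda>x. - \<alpha> x) lam (\<lambda>x. - u x)"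
    unfolding solution_iff
  proof (intro exI[of _ "\<lambda>x. - u' x"] conjI ballI)
    fix x :: real assume x: "x \<in> {0<..<1}"
    show "((\<lambda>t. phi p (- u' t)) has_real_derivative
        - rhs p a (\<lambda>x. - \<beta> x) (\<lambda>x. - \<alpha> x) lam x (- u x)) (at x)"
      unfolding rhs_minus using DERIV_minus[OF u'(5)[OF x]] by simp
  qed (use u' in \<open>auto intro: continuous_intros DERIV_minus\<close>)
  then show ?thesis using assms by (simp add: nontrivial_solution_def)
qed

lemma deriv01_minus:
  assumes "u \<in> E" "x \<in> {0..1}"
  shows "deriv01 (\<lambda>x. - u x) x = - deriv01 u x"
  using assms by (intro deriv01_eq DERIV_minus has_real_derivative_deriv01) (auto simp: E_def)

lemma eventually_pos_at_right_0:
  assumes "(u has_real_derivative d) (at 0 within {0..1})" "u 0 = 0" "0 < d"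
  shows "\<forall>\<^sub>F x in at_right 0. 0 < u x"
proof -
  obtain e where e: "0 < e" "\<And>h. 0 < h \<Longrightarrow> h \<in> {0..1} \<Longrightarrow> h < e \<Longrightarrow> 0 < u h"
    using has_real_derivative_pos_inc_right[OF assms(1,3)] assms(2) by auto
  then show ?thesis
    unfolding eventually_at_right_field by (intro exI[of _ "min e 1"]) auto
qed

section \<open>The modified Pruefer transformation\<close>

lemma abs_sin_diff_le: "\<bar>sin s - sin t\<bar> \<le> \<bar>s - t\<bar>" for s t :: real
proof -
  have "\<bar>sin s - sin t\<bar> = 2 * (\<bar>sin ((s - t) / 2)\<bar> * \<bar>cos ((s + t) / 2)\<bar>)"
    by (simp add: sin_diff_sin abs_mult)
  also have "\<dots> \<le> 2 * (\<bar>(s - t) / 2\<bar> * 1)"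
    by (intro mult_left_mono mult_mono abs_sin_x_le_abs_x) auto
  finally show ?thesis by simp
qed

lemma abs_cos_diff_le: "\<bar>cos s - cos t\<bar> \<le> \<bar>s - t\<bar>" for s t :: real
  using abs_sin_diff_le[of "pi / 2 - s" "pi / 2 - t"] by (simp add: sin_diff abs_minus_commute)

locale half_quasilinear =
  fixes p :: real and a \<alpha> \<beta> :: "real \<Rightarrow> real"
  assumes p: "1 < p"
    and cont_a: "continuous_on {0..1} a" and a_pos: "\<And>x. x \<in> {0..1} \<Longrightarrow> 0 < a x"
    and cont_\<alpha>: "continuous_on {0..1} \<alpha>" and cont_\<beta>: "continuous_on {0..1} \<beta>"
begin

definition q where "q = p / (p - 1)"

lemma q: "1 < q" "(p - 1) * (q - 1) = 1" "(q - 1) * (p - 1) = 1"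
  using p by (auto simp: q_def field_simps)

abbreviation force where "force \<equiv> rhs p a \<alpha> \<beta>"

text \<open>Inserting \<open>u = r sin \<theta>\<close>, \<open>v = r\<^sup>p\<^sup>-\<^sup>1 cos \<theta>\<close> into the planar system and dividing by powers of \<open>r\<close> gives two
  linear equations for \<open>\<theta>'\<close> and \<open>l = r'/r\<close>,
    \<open>l sin \<theta> + \<theta>' cos \<theta> = \<phi>\<^sub>q(cos \<theta>)\<close> and
    \<open>(p - 1) l cos \<theta> - \<theta>' sin \<theta> = - force(sin \<theta>)\<close>.
  Up to sign, \<open>den\<close> is their determinant, and \<open>rot\<close> and \<open>growth\<close> are the solutions \<open>\<theta>'\<close> and \<open>l\<close>.\<close>

definition den where "den \<theta> = (p - 1) * (cos \<theta>)\<^sup>2 + (sin \<theta>)\<^sup>2"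

definition rot where
  "rot lam x \<theta> = ((p - 1) * \<bar>cos \<theta>\<bar> powr q + sin \<theta> * force lam x (sin \<theta>)) / den \<theta>"

definition growth where
  "growth lam x \<theta> = (sin \<theta> * phi q (cos \<theta>) - cos \<theta> * force lam x (sin \<theta>)) / den \<theta>"

lemma den_alt: "den \<theta> = 1 + (p - 2) * (cos \<theta>)\<^sup>2"
  by (simp add: den_def sin_squared_eq algebra_simps)

lemma den_ge: "min 1 (p - 1) \<le> den \<theta>"
proof -
  have "min 1 (p - 1) * (cos \<theta>)\<^sup>2 + min 1 (p - 1) * (sin \<theta>)\<^sup>2 \<le> den \<theta>"
    unfolding den_def
    by (intro add_mono mult_right_mono) (auto intro: order_trans[OF mult_right_mono[of "min 1 (p - 1)" 1]])
  moreover have "min 1 (p - 1) * (cos \<theta>)\<^sup>2 + min 1 (p - 1) * (sin \<theta>)\<^sup>2 = min 1 (p - 1)"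
    by (simp flip: distrib_left)
  ultimately show ?thesis by simp
qed

lemma den_pos: "0 < den \<theta>"
  using den_ge[of \<theta>] p by (auto simp: min_def split: if_splits)

lemma mult_force:
  "s * force lam x s = lam * a x * \<bar>s\<bar> powr p + \<alpha> x * pos_part s powr p - \<beta> x * neg_part s powr p"
proof -
  have "s * force lam x s = lam * a x * (s * phi p s) + \<alpha> x * (s * phi p (pos_part s)) +
      \<beta> x * (s * phi p (neg_part s))"
    by (simp add: rhs_def distrib_left mult.left_commute)
  then show ?thesis unfolding mult_phi mult_phi_pos_part mult_phi_neg_part by simp
qed

lemma coefficient_bound:
  "\<exists>M. \<forall>x \<in> {0..1}. \<bar>a x\<bar> \<le> M \<and> \<bar>\<alpha> x\<bar> \<le> M \<and> \<bar>\<beta> x\<bar> \<le> M"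
proof -
  have "\<exists>M. \<forall>x \<in> {0..1}. \<bar>f x\<bar> \<le> M" if "continuous_on {0..1} f" for f :: "real \<Rightarrow> real"
    using compact_imp_bounded[OF compact_continuous_image[OF that compact_Icc]]
    by (auto simp: bounded_iff)
  then obtain M1 M2 M3 where "\<forall>x \<in> {0..1}. \<bar>a x\<bar> \<le> M1" "\<forall>x \<in> {0..1}. \<bar>\<alpha> x\<bar> \<le> M2"
    "\<forall>x \<in> {0..1}. \<bar>\<beta> x\<bar> \<le> M3"
    using cont_a cont_\<alpha> cont_\<beta> by meson
  then show ?thesis
    by (intro exI[of _ "max M1 (max M2 M3)"]) (auto simp: le_max_iff_disj)
qed

text \<open>The numerator of \<open>rot\<close> is a combination of functions bounded by 1 and Lipschitz in the angle; division by
  \<open>den\<close> preserves the Lipschitz property, \<open>den\<close> being Lipschitz and bounded away from 0.\<close>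

lemma lipschitz_divide_den:
  assumes "\<And>t. \<bar>f t\<bar> \<le> 1" "\<And>s t. \<bar>f s - f t\<bar> \<le> K * \<bar>s - t\<bar>"
  shows "\<exists>L \<ge> 0. \<forall>s t. \<bar>f s / den s - f t / den t\<bar> \<le> L * \<bar>s - t\<bar>"
proof -
  define \<delta> where "\<delta> = min 1 (p - 1)"
  have \<delta>: "0 < \<delta>" "\<delta> \<le> den t" for t using p den_ge by (auto simp: \<delta>_def)
  have K: "0 \<le> K" using assms(2)[of 0 1] by auto
  have "\<bar>f s / den s - f t / den t\<bar> \<le> (K / \<delta> + 2 * \<bar>p - 2\<bar> / \<delta>\<^sup>2) * \<bar>s - t\<bar>" for s t
  proof -
    have d: "\<bar>den t - den s\<bar> \<le> 2 * \<bar>p - 2\<bar> * \<bar>s - t\<bar>"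
    proof -
      have "den t - den s = (p - 2) * ((cos t - cos s) * (cos t + cos s))"
        by (simp add: den_alt algebra_simps power2_eq_square)
      then have "\<bar>den t - den s\<bar> = \<bar>p - 2\<bar> * (\<bar>cos t - cos s\<bar> * \<bar>cos t + cos s\<bar>)"
        by (simp add: abs_mult)
      also have "\<dots> \<le> \<bar>p - 2\<bar> * (\<bar>t - s\<bar> * (1 + 1))"
        by (intro mult_left_mono mult_mono abs_cos_diff_le order_trans[OF abs_triangle_ineq add_mono])
          auto
      finally show ?thesis by (simp add: mult_ac abs_minus_commute)
    qed
    have "f s / den s - f t / den t = (f s - f t) / den s + f t * ((den t - den s) / (den s * den t))"
      using den_pos[of s] den_pos[of t] by (simp add: field_simps)
    then have "\<bar>f s / den s - f t / den t\<bar> \<le>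
        \<bar>f s - f t\<bar> / den s + \<bar>f t\<bar> * (\<bar>den t - den s\<bar> / (den s * den t))"
      using den_pos[of s] den_pos[of t]
        abs_triangle_ineq[of "(f s - f t) / den s" "f t * ((den t - den s) / (den s * den t))"]
      by (simp add: abs_mult)
    also have "\<dots> \<le> K * \<bar>s - t\<bar> / \<delta> + 1 * (2 * \<bar>p - 2\<bar> * \<bar>s - t\<bar> / (\<delta> * \<delta>))"
      using d K \<delta> den_pos[of s] den_pos[of t] assms
      by (intro add_mono mult_mono frac_le) auto
    finally show ?thesis by (simp add: power2_eq_square add_divide_distrib distrib_right)
  qed
  then show ?thesis using K \<delta>(1) by (intro exI[of _ "K / \<delta> + 2 * \<bar>p - 2\<bar> / \<delta>\<^sup>2"]) auto
qed

text \<open>The force enters only through \<open>s * force lam x s\<close>, \<open>s = sin \<theta>\<close>, and the extra factor \<open>s\<close> raises its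
  exponent \<open>p - 1\<close>, which may be below 1, to \<open>p > 1\<close>.  Likewise \<open>\<bar>cos \<theta>\<bar>\<^sup>q = cos \<theta> \<phi>\<^sub>q(cos \<theta>)\<close> has the exponent
  \<open>q > 1\<close> instead of \<open>q - 1\<close>.\<close>

lemma rot_lipschitz:
  "\<exists>L. \<forall>x \<in> {0..1}. \<forall>s t. \<bar>rot lam x s - rot lam x t\<bar> \<le> L * \<bar>s - t\<bar>"
proof -
  obtain M where M: "\<And>x. x \<in> {0..1} \<Longrightarrow> \<bar>a x\<bar> \<le> M \<and> \<bar>\<alpha> x\<bar> \<le> M \<and> \<bar>\<beta> x\<bar> \<le> M"
    using coefficient_bound by blast
  have "\<exists>L \<ge> 0. \<forall>s t. \<bar>f s powr r / den s - f t powr r / den t\<bar> \<le> L * \<bar>s - t\<bar>"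
    if r: "1 < r" and f: "\<And>t. 0 \<le> f t" "\<And>t. f t \<le> 1" "\<And>s t. \<bar>f s - f t\<bar> \<le> \<bar>s - t\<bar>" for f r
  proof (rule lipschitz_divide_den)
    show "\<bar>f t powr r\<bar> \<le> 1" for t
      using powr_mono2[of r "f t" 1] r f(1)[of t] f(2)[of t] by simp
    show "\<bar>f s powr r - f t powr r\<bar> \<le> r * \<bar>s - t\<bar>" for s t
    proof -
      have "\<bar>f s powr r - f t powr r\<bar> \<le> r * \<bar>f s - f t\<bar>"
        using powr_lipschitz[OF r f(1)[of s] f(2) f(1)[of t] f(2)] by simp
      also have "\<dots> \<le> r * \<bar>s - t\<bar>"
        using r f(3) by (intro mult_left_mono) auto
      finally show ?thesis .
    qed
  qed
  note lip = this
  have sin: "\<bar>sin t\<bar> \<le> 1" "\<bar>\<bar>sin s\<bar> - \<bar>sin t\<bar>\<bar> \<le> \<bar>s - t\<bar>"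
    "0 \<le> pos_part (sin t)" "pos_part (sin t) \<le> 1" "\<bar>pos_part (sin s) - pos_part (sin t)\<bar> \<le> \<bar>s - t\<bar>"
    "0 \<le> neg_part (sin t)" "neg_part (sin t) \<le> 1" "\<bar>neg_part (sin s) - neg_part (sin t)\<bar> \<le> \<bar>s - t\<bar>"
    for s t :: real
    using abs_sin_diff_le[of s t] pos_part_lipschitz[of "sin s" "sin t"] pos_part_bounds[of "sin t"]
      neg_part_lipschitz[of "sin s" "sin t"] neg_part_bounds[of "sin t"] abs_sin_le_one[of t]
    by linarith+
  have cos: "\<bar>\<bar>cos s\<bar> - \<bar>cos t\<bar>\<bar> \<le> \<bar>s - t\<bar>" for s t :: real
    using abs_cos_diff_le[of s t] by linarith
  obtain L0 where L0: "0 \<le> L0"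
    "\<And>s t. \<bar>\<bar>cos s\<bar> powr q / den s - \<bar>cos t\<bar> powr q / den t\<bar> \<le> L0 * \<bar>s - t\<bar>"
    using lip[OF q(1), of "\<lambda>t. \<bar>cos t\<bar>"] cos by auto
  obtain L1 where L1: "0 \<le> L1"
    "\<And>s t. \<bar>\<bar>sin s\<bar> powr p / den s - \<bar>sin t\<bar> powr p / den t\<bar> \<le> L1 * \<bar>s - t\<bar>"
    using lip[OF p, of "\<lambda>t. \<bar>sin t\<bar>"] sin by auto
  obtain L2 where L2: "0 \<le> L2"
    "\<And>s t. \<bar>pos_part (sin s) powr p / den s - pos_part (sin t) powr p / den t\<bar> \<le> L2 * \<bar>s - t\<bar>"
    using lip[OF p, of "\<lambda>t. pos_part (sin t)"] sin by auto
  obtain L3 where L3: "0 \<le> L3"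
    "\<And>s t. \<bar>neg_part (sin s) powr p / den s - neg_part (sin t) powr p / den t\<bar> \<le> L3 * \<bar>s - t\<bar>"
    using lip[OF p, of "\<lambda>t. neg_part (sin t)"] sin by auto
  have "\<bar>rot lam x s - rot lam x t\<bar> \<le>
      ((p - 1) * L0 + \<bar>lam\<bar> * M * L1 + M * L2 + M * L3) * \<bar>s - t\<bar>" if x: "x \<in> {0..1}" for x s t
  proof -
    have eq: "rot lam x s - rot lam x t =
        (p - 1) * (\<bar>cos s\<bar> powr q / den s - \<bar>cos t\<bar> powr q / den t) +
        lam * a x * (\<bar>sin s\<bar> powr p / den s - \<bar>sin t\<bar> powr p / den t) +
        \<alpha> x * (pos_part (sin s) powr p / den s - pos_part (sin t) powr p / den t) +
        - \<beta> x * (neg_part (sin s) powr p / den s - neg_part (sin t) powr p / den t)"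
      unfolding rot_def mult_force
      by (simp add: add_divide_distrib diff_divide_distrib right_diff_distrib)
    have "\<bar>rot lam x s - rot lam x t\<bar> \<le>
        \<bar>(p - 1) * (\<bar>cos s\<bar> powr q / den s - \<bar>cos t\<bar> powr q / den t)\<bar> +
        \<bar>lam * a x * (\<bar>sin s\<bar> powr p / den s - \<bar>sin t\<bar> powr p / den t)\<bar> +
        \<bar>\<alpha> x * (pos_part (sin s) powr p / den s - pos_part (sin t) powr p / den t)\<bar> +
        \<bar>- \<beta> x * (neg_part (sin s) powr p / den s - neg_part (sin t) powr p / den t)\<bar>"
    proof -
      have "\<bar>w + x + y + z\<bar> \<le> \<bar>w\<bar> + \<bar>x\<bar> + \<bar>y\<bar> + \<bar>z\<bar>" for w x y z :: real by linarith
      then show ?thesis unfolding eq .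
    qed
    also have "\<dots> \<le> (p - 1) * (L0 * \<bar>s - t\<bar>) + \<bar>lam\<bar> * M * (L1 * \<bar>s - t\<bar>) +
        M * (L2 * \<bar>s - t\<bar>) + M * (L3 * \<bar>s - t\<bar>)"
      unfolding abs_mult using M[OF x] p L0 L1 L2 L3
      by (intro add_mono mult_mono) auto
    finally show ?thesis by (simp add: algebra_simps)
  qed
  then show ?thesis by blast
qed

lemma cont_force:
  "continuous_on {0..1} f \<Longrightarrow> continuous_on {0..1} (\<lambda>t. force lam t (f t))"
  unfolding rhs_def by (intro continuous_intros cont_a cont_\<alpha> cont_\<beta> p)

lemma cont_rot:
  "continuous_on {0..1} f \<Longrightarrow> continuous_on {0..1} (\<lambda>t. rot lam t (f t))"
  unfolding rot_def using den_pos less_imp_neq[OF den_pos] q(1)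
  by (intro continuous_intros cont_force continuous_on_powr') (auto simp: den_def[abs_def] intro!: continuous_intros)

lemma cont_growth:
  "continuous_on {0..1} f \<Longrightarrow> continuous_on {0..1} (\<lambda>t. growth lam t (f t))"
  unfolding growth_def using less_imp_neq[OF den_pos] q(1)
  by (intro continuous_intros cont_force) (auto simp: den_def[abs_def] intro!: continuous_intros)

definition angle where
  "angle lam = (SOME \<theta>. \<theta> 0 = 0 \<and>
    (\<forall>x \<in> {0..1}. (\<theta> has_real_derivative rot lam x (\<theta> x)) (at x within {0..1})))"

lemma angle: "angle lam 0 = 0"
  "x \<in> {0..1} \<Longrightarrow> (angle lam has_real_derivative rot lam x (angle lam x)) (at x within {0..1})"
proof -
  obtain L where "\<forall>x \<in> {0..1}. \<forall>s t. \<bar>rot lam x s - rot lam x t\<bar> \<le> L * \<bar>s - t\<bar>"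
    using rot_lipschitz by blast
  then have "\<exists>\<theta>. \<theta> 0 = 0 \<and>
      (\<forall>x \<in> {0..1}. (\<theta> has_real_derivative rot lam x (\<theta> x)) (at x within {0..1}))"
    by (intro picard_lindeloef[where L = L] cont_rot) auto
  from someI_ex[OF this] show "angle lam 0 = 0"
    "x \<in> {0..1} \<Longrightarrow> (angle lam has_real_derivative rot lam x (angle lam x)) (at x within {0..1})"
    unfolding angle_def by auto
qed

lemma cont_angle: "continuous_on {0..1} (angle lam)"
  using angle(2) by (rule DERIV_continuous_on)

lemma angle_DERIV:
  "0 < x \<Longrightarrow> x < 1 \<Longrightarrow> (angle lam has_real_derivative rot lam x (angle lam x)) (at x)"
  using angle(2)[of x lam] at_within_Icc_at[of 0 x 1] by auto

definition amp where
  "amp lam x = exp (integral {0..x} (\<lambda>t. growth lam t (angle lam t)))"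

lemma amp_pos [simp]: "0 < amp lam x" and amp_nonzero [simp]: "amp lam x \<noteq> 0"
  and abs_amp [simp]: "\<bar>amp lam x\<bar> = amp lam x"
  by (simp_all add: amp_def)

lemma amp_deriv:
  assumes "x \<in> {0..1}"
  shows "(amp lam has_real_derivative amp lam x * growth lam x (angle lam x)) (at x within {0..1})"
  unfolding amp_def
  by (rule DERIV_chain2[OF DERIV_exp integral_has_real_derivative[OF cont_growth[OF cont_angle] assms]])

text \<open>The shooting solution \<open>(U, V)\<close>, with initial value \<open>(0, 1)\<close>.\<close>

definition U where "U lam x = amp lam x * sin (angle lam x)"
definition V where "V lam x = amp lam x powr (p - 1) * cos (angle lam x)"

lemma UV_0: "U lam 0 = 0" "V lam 0 = 1"
  by (auto simp: U_def V_def amp_def angle)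

lemma UV_nonzero: "(U lam x, V lam x) \<noteq> (0, 0)"
  using sin_zero_abs_cos_one[of "angle lam x"] by (auto simp: U_def V_def)

lemma phi_V: "phi q (V lam x) = amp lam x * phi q (cos (angle lam x))"
  by (simp add: V_def phi_mult phi_pos powr_powr q)

lemma U_deriv:
  assumes x: "x \<in> {0..1}"
  shows "(U lam has_real_derivative phi q (V lam x)) (at x within {0..1})"
proof -
  let ?\<theta> = "angle lam x"
  have D: "(U lam has_real_derivative amp lam x * growth lam x ?\<theta> * sin ?\<theta> +
      cos ?\<theta> * rot lam x ?\<theta> * amp lam x) (at x within {0..1})"
    unfolding U_def by (rule DERIV_mult amp_deriv[OF x] DERIV_chain2[OF DERIV_sin angle(2)[OF x]])+
  have id: "growth lam x ?\<theta> * sin ?\<theta> + cos ?\<theta> * rot lam x ?\<theta> = phi q (cos ?\<theta>)"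
  proof -
    have "growth lam x ?\<theta> * sin ?\<theta> + cos ?\<theta> * rot lam x ?\<theta> = phi q (cos ?\<theta>) * den ?\<theta> / den ?\<theta>"
      unfolding growth_def rot_def mult_phi[symmetric] times_divide_eq_left times_divide_eq_right
        add_divide_distrib[symmetric]
      by (rule arg_cong[of _ _ "\<lambda>s. s / den ?\<theta>"])
        (simp add: den_def algebra_simps power2_eq_square)
    then show ?thesis using den_pos[of ?\<theta>] by simp
  qed
  have "amp lam x * growth lam x ?\<theta> * sin ?\<theta> + cos ?\<theta> * rot lam x ?\<theta> * amp lam x =
      phi q (V lam x)"
    unfolding phi_V id[symmetric] by (simp only: algebra_simps)
  with D show ?thesis by simp
qed

lemma V_deriv:
  assumes x: "x \<in> {0..1}"
  shows "(V lam has_real_derivative - force lam x (U lam x)) (at x within {0..1})"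
proof -
  let ?\<theta> = "angle lam x"
  have P: "((\<lambda>x. amp lam x powr (p - 1)) has_real_derivative
      (p - 1) * amp lam x powr (p - 1) * growth lam x ?\<theta>) (at x within {0..1})"
    using DERIV_chain2[OF has_real_derivative_powr[OF amp_pos, of "p - 1"] amp_deriv[OF x]]
      powr_add[of "amp lam x" "p - 1 - 1" 1]
    by (simp add: mult_ac)
  have D: "(V lam has_real_derivative (p - 1) * amp lam x powr (p - 1) * growth lam x ?\<theta> * cos ?\<theta> +
      - sin ?\<theta> * rot lam x ?\<theta> * amp lam x powr (p - 1)) (at x within {0..1})"
    unfolding V_def by (rule DERIV_mult P DERIV_chain2[OF DERIV_cos angle(2)[OF x]])+
  have id: "(p - 1) * growth lam x ?\<theta> * cos ?\<theta> + - sin ?\<theta> * rot lam x ?\<theta> = - force lam x (sin ?\<theta>)"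
  proof -
    have "(p - 1) * growth lam x ?\<theta> * cos ?\<theta> + - sin ?\<theta> * rot lam x ?\<theta> =
        - force lam x (sin ?\<theta>) * den ?\<theta> / den ?\<theta>"
      unfolding growth_def rot_def mult_phi[symmetric] times_divide_eq_left times_divide_eq_right
        add_divide_distrib[symmetric]
      by (rule arg_cong[of _ _ "\<lambda>s. s / den ?\<theta>"])
        (simp add: den_def algebra_simps power2_eq_square)
    then show ?thesis using den_pos[of ?\<theta>] by simp
  qed
  have "- force lam x (U lam x) = amp lam x powr (p - 1) * - force lam x (sin ?\<theta>)"
    by (simp add: U_def rhs_mult phi_pos)
  also have "\<dots> = (p - 1) * amp lam x powr (p - 1) * growth lam x ?\<theta> * cos ?\<theta> +
      - sin ?\<theta> * rot lam x ?\<theta> * amp lam x powr (p - 1)"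
    unfolding id[symmetric] by (simp only: algebra_simps)
  finally show ?thesis using D by simp
qed

lemma minus_force_eq:
  "- force lam x s = - (lam * a x + \<alpha> x) * phi p (pos_part s) + (lam * a x - \<beta> x) * phi p (neg_part s)"
  unfolding rhs_def by (subst phi_decompose[of p s]) (simp add: algebra_simps)

lemma cont_U: "continuous_on {0..1} (U lam)" and cont_V: "continuous_on {0..1} (V lam)"
  by (rule DERIV_continuous_on[OF U_deriv], assumption) (rule DERIV_continuous_on[OF V_deriv])

abbreviation planar where
  "planar lam \<equiv> planar_solution p q (\<lambda>x. - (lam * a x + \<alpha> x)) (\<lambda>x. lam * a x - \<beta> x) 0 1"

lemma planar_UV:
  assumes c: "0 < c"
  shows "planar lam (\<lambda>x. c * U lam x) (\<lambda>x. phi p c * V lam x)"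
proof -
  have "((\<lambda>x. c * U lam x) has_real_derivative phi q (phi p c * V lam x)) (at x)"
    "((\<lambda>x. phi p c * V lam x) has_real_derivative - force lam x (c * U lam x)) (at x)"
    if x: "0 < x" "x < 1" for x
  proof -
    have "at x within {0..1} = at x" using x by (rule at_within_Icc_at)
    then have "(U lam has_real_derivative phi q (V lam x)) (at x)"
      "(V lam has_real_derivative - force lam x (U lam x)) (at x)"
      using U_deriv[of x lam] V_deriv[of x lam] x by auto
    from DERIV_cmult[OF this(1), of c] DERIV_cmult[OF this(2), of "phi p c"]
    show "((\<lambda>x. c * U lam x) has_real_derivative phi q (phi p c * V lam x)) (at x)"
      "((\<lambda>x. phi p c * V lam x) has_real_derivative - force lam x (c * U lam x)) (at x)"
      unfolding rhs_mult[OF c] by (simp_all add: phi_mult phi_phi_conjugate[OF q(3)])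
  qed
  then show ?thesis
    unfolding planar_solution_def minus_force_eq[symmetric]
    by (auto intro: continuous_intros cont_U cont_V)
qed

lemma planar_of_solution:
  assumes "solution p a \<alpha> \<beta> lam u"
  shows "planar lam u (\<lambda>x. phi p (deriv01 u x))"
proof -
  have u: "u \<in> E" using assms by (simp add: solution_def)
  have d: "(u has_real_derivative deriv01 u x) (at x within {0..1})" if "x \<in> {0..1}" for x
    using u that by (auto simp: E_def intro: has_real_derivative_deriv01)
  have "continuous_on {0..1} u" using d by (rule DERIV_continuous_on)
  moreover have "continuous_on {0..1} (\<lambda>x. phi p (deriv01 u x))"
    using u by (auto simp: E_def intro!: continuous_intros p)
  moreover have "(u has_real_derivative phi q (phi p (deriv01 u x))) (at x)" if x: "0 < x" "x < 1" for x
    using d[of x] x at_within_Icc_at[of 0 x 1] phi_phi_conjugate[OF q(3)] by simp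
  moreover have "((\<lambda>x. phi p (deriv01 u x)) has_real_derivative - force lam x (u x)) (at x)"
    if x: "0 < x" "x < 1" for x
    using assms x by (auto simp: solution_def rhs_def)
  ultimately show ?thesis
    unfolding planar_solution_def minus_force_eq[symmetric] by auto
qed

lemma planar_coefficients_bound:
  "\<exists>B. \<forall>x. 0 < x \<longrightarrow> x < 1 \<longrightarrow> \<bar>- (lam * a x + \<alpha> x)\<bar> \<le> B \<and> \<bar>lam * a x - \<beta> x\<bar> \<le> B"
proof -
  obtain M where M: "\<And>x. x \<in> {0..1} \<Longrightarrow> \<bar>a x\<bar> \<le> M \<and> \<bar>\<alpha> x\<bar> \<le> M \<and> \<bar>\<beta> x\<bar> \<le> M"
    using coefficient_bound by blast
  have "\<bar>- (lam * a x + \<alpha> x)\<bar> \<le> \<bar>lam\<bar> * M + M \<and> \<bar>lam * a x - \<beta> x\<bar> \<le> \<bar>lam\<bar> * M + M"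
    if "0 < x" "x < 1" for x
  proof -
    have "\<bar>lam * a x\<bar> \<le> \<bar>lam\<bar> * M"
      unfolding abs_mult using M[of x] that by (intro mult_left_mono) auto
    then show ?thesis using M[of x] that by auto
  qed
  then show ?thesis by blast
qed

text \<open>If \<open>u'(0) = 0\<close>, then \<open>(u, \<phi>\<^sub>p(u'))\<close> starts at the origin and stays there.\<close>

lemma deriv01_0_nonzero:
  assumes "nontrivial_solution p a \<alpha> \<beta> lam u"
  shows "deriv01 u 0 \<noteq> 0"
proof
  assume *: "deriv01 u 0 = 0"
  have sol: "planar lam u (\<lambda>x. phi p (deriv01 u x))" and "u 0 = 0"
    using assms planar_of_solution by (auto simp: nontrivial_solution_def solution_def E_def)
  obtain B where "\<And>x. 0 < x \<Longrightarrow> x < 1 \<Longrightarrow> \<bar>- (lam * a x + \<alpha> x)\<bar> \<le> B \<and> \<bar>lam * a x - \<beta> x\<bar> \<le> B"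
    using planar_coefficients_bound by blast
  then have "u x = 0" if "x \<in> {0..1}" for x
    using planar_solution_zero[OF p q(1,2) _ sol, of B x] * \<open>u 0 = 0\<close> that by simp
  then show False using assms by (auto simp: nontrivial_solution_def)
qed

text \<open>With \<open>c = u'(0)\<close>, the curves \<open>(u, \<phi>\<^sub>p(u'))\<close> and \<open>(c U, c\<^sup>p\<^sup>-\<^sup>1 V)\<close> solve the same system with the same
  initial value, and the second one avoids the origin.\<close>

lemma solution_eq_U:
  assumes "nontrivial_solution p a \<alpha> \<beta> lam u" "0 < deriv01 u 0" "x \<in> {0..1}"
  shows "u x = deriv01 u 0 * U lam x"
proof -
  define c where "c = deriv01 u 0"
  have c: "0 < c" using assms by (simp add: c_def)
  have sol: "planar lam u (\<lambda>x. phi p (deriv01 u x))" and "u 0 = 0"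
    using assms planar_of_solution by (auto simp: nontrivial_solution_def solution_def E_def)
  obtain B where B: "\<And>x. 0 < x \<Longrightarrow> x < 1 \<Longrightarrow> \<bar>- (lam * a x + \<alpha> x)\<bar> \<le> B \<and> \<bar>lam * a x - \<beta> x\<bar> \<le> B"
    using planar_coefficients_bound by blast
  have "c * U lam x = u x \<and> phi p c * V lam x = phi p (deriv01 u x)"
    by (rule planar_unique[OF p q(1,2) B planar_UV[OF c] sol _ _ _ assms(3)])
      (use c UV_nonzero[of lam] UV_0 \<open>u 0 = 0\<close> in \<open>auto simp: c_def\<close>)
  then show ?thesis by (simp add: c_def)
qed

lemma proportional:
  assumes "nontrivial_solution p a \<alpha> \<beta> lam u" "nontrivial_solution p a \<alpha> \<beta> lam v"
    and "0 < deriv01 u 0" "0 < deriv01 v 0"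
  shows "\<exists>c > 0. \<forall>x \<in> {0..1}. v x = c * u x"
  using solution_eq_U[OF assms(1,3)] solution_eq_U[OF assms(2,4)] assms(3,4)
  by (intro exI[of _ "deriv01 v 0 / deriv01 u 0"]) auto

lemma U_solution:
  assumes "U lam 1 = 0"
  shows "nontrivial_solution p a \<alpha> \<beta> lam (U lam)"
proof -
  have "solution p a \<alpha> \<beta> lam (U lam)"
    unfolding solution_iff
  proof (intro exI[of _ "\<lambda>x. phi q (V lam x)"] conjI ballI)
    fix x :: real assume x: "x \<in> {0<..<1}"
    show "((\<lambda>t. phi p (phi q (V lam t))) has_real_derivative - force lam x (U lam x)) (at x)"
      using V_deriv[of x lam] x at_within_Icc_at[of 0 x 1] phi_phi_conjugate[OF q(2)] by auto
  qed (use U_deriv UV_0 assms cont_V q in \<open>auto intro: continuous_intros\<close>)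
  moreover have "\<exists>x \<in> {0..1}. U lam x \<noteq> 0"
  proof -
    have "\<forall>\<^sub>F x in at_right 0. 0 < U lam x"
      using eventually_pos_at_right_0[OF U_deriv[of 0 lam]] UV_0 by simp
    then obtain e where "0 < e" "\<forall>x > 0. x < e \<longrightarrow> 0 < U lam x"
      by (auto simp: eventually_at_right_field)
    then have "0 < U lam (min (e / 2) 1)" by auto
    then show ?thesis using \<open>0 < e\<close> by (intro bexI[of _ "min (e / 2) 1"]) auto
  qed
  ultimately show ?thesis by (auto simp: nontrivial_solution_def)
qed

section \<open>The angle as a function of position\<close>

lemma rot_at_zero: "sin \<theta> = 0 \<Longrightarrow> rot lam x \<theta> = 1"
  using p sin_zero_abs_cos_one[of \<theta>] sin_cos_squared_add[of \<theta>] by (simp add: rot_def den_def)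

text \<open>The reason for the exact count of zeros: by \<open>rot_at_zero\<close> the angle has slope 1 whenever it is a multiple
  of \<open>\<pi>\<close>, whatever the coefficients are.\<close>

lemma angle_crosses:
  assumes "0 \<le> x" "x < y" "y \<le> 1" "real j * pi \<le> angle lam x"
  shows "real j * pi < angle lam y"
proof -
  have "0 < angle lam y - real j * pi"
  proof (rule crosses_upwards[OF assms(2)])
    show "continuous_on {x..y} (\<lambda>x. angle lam x - real j * pi)"
      using assms by (intro continuous_intros continuous_on_subset[OF cont_angle]) auto
    fix z assume z: "x \<le> z" "z \<le> y" "angle lam z - real j * pi = 0"
    then have "sin (angle lam z) = 0" by simp
    then have "((\<lambda>x. angle lam x - real j * pi) has_real_derivative 1) (at z within {x..y})"
      using DERIV_subset[OF angle(2)[of z lam], of "{x..y}"] z assms rot_at_zero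
      by (auto intro!: derivative_eq_intros)
    then show "\<exists>d > 0. ((\<lambda>x. angle lam x - real j * pi) has_real_derivative d) (at z within {x..y})"
      by (intro exI[of _ 1]) simp
  qed (use assms in auto)
  then show ?thesis by simp
qed

lemma angle_pos: "0 < x \<Longrightarrow> x \<le> 1 \<Longrightarrow> 0 < angle lam x"
  using angle_crosses[of 0 x 0 lam] angle(1) by simp

lemma U_zero_iff: "U lam x = 0 \<longleftrightarrow> sin (angle lam x) = 0"
  by (simp add: U_def)

lemma U_1_zero_iff: "U lam 1 = 0 \<longleftrightarrow> (\<exists>k \<ge> 1. angle lam 1 = real k * pi)"
proof
  assume "U lam 1 = 0"
  then obtain i :: int where i: "angle lam 1 = of_int i * pi"
    by (auto simp: U_zero_iff sin_zero_iff_int2)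
  moreover have "0 < i" using angle_pos[of 1 lam] i by (simp add: zero_less_mult_iff)
  ultimately show "\<exists>k \<ge> 1. angle lam 1 = real k * pi"
    by (intro exI[of _ "nat i"]) auto
qed (auto simp: U_zero_iff)

text \<open>The map \<open>x \<mapsto> angle lam x / \<pi>\<close> is a bijection from the interior zeros onto \<open>{1..<k}\<close>: injective by
  \<open>angle_crosses\<close>, onto by the intermediate value theorem.\<close>

lemma interior_zeros_of_U:
  assumes k: "angle lam 1 = real k * pi"
  shows "finite {x \<in> {0<..<1}. U lam x = 0} \<and> card {x \<in> {0<..<1}. U lam x = 0} = k - 1"
proof -
  let ?Z = "{x \<in> {0<..<1}. U lam x = 0}" and ?f = "\<lambda>x. angle lam x / pi"
  have img: "?f ` ?Z = real ` {1..<k}"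
  proof (intro equalityI subsetI)
    fix t assume "t \<in> ?f ` ?Z"
    then obtain x where x: "0 < x" "x < 1" "sin (angle lam x) = 0" "t = angle lam x / pi"
      by (auto simp: U_zero_iff)
    then obtain i :: int where i: "angle lam x = of_int i * pi"
      by (auto simp: sin_zero_iff_int2)
    have "0 < i" using angle_pos[of x lam] x i by (simp add: zero_less_mult_iff)
    have t: "t = real (nat i)" using x i \<open>0 < i\<close> by simp
    have "\<not> k \<le> nat i"
    proof
      assume "k \<le> nat i"
      then have "real k * pi \<le> angle lam x" using i \<open>0 < i\<close> by simp
      then show False using angle_crosses[of x 1 k lam] x k by simp
    qed
    then show "t \<in> real ` {1..<k}" using t \<open>0 < i\<close> by (intro image_eqI[of _ _ "nat i"]) auto
  next
    fix t assume "t \<in> real ` {1..<k}"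
    then obtain j where j: "1 \<le> j" "j < k" "t = real j" by auto
    have "\<exists>x \<ge> 0. x \<le> 1 \<and> angle lam x = real j * pi"
      by (rule IVT') (use j k cont_angle angle(1) in auto)
    then obtain x where x: "0 \<le> x" "x \<le> 1" "angle lam x = real j * pi" by blast
    moreover have "x \<noteq> 0" using x j angle(1)[of lam] by auto
    moreover have "x \<noteq> 1" using x j k by auto
    ultimately show "t \<in> ?f ` ?Z" using j by (intro image_eqI[of _ _ x]) (auto simp: U_zero_iff)
  qed
  have "inj_on ?f ?Z"
  proof (rule linorder_inj_onI)
    fix x y assume xy: "x < y" "x \<in> ?Z" "y \<in> ?Z"
    then have "?f x \<in> real ` {1..<k}" using img by blast
    then obtain j :: nat where "angle lam x = real j * pi" by (auto simp: field_simps)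
    then show "?f x \<noteq> ?f y" using angle_crosses[of x y j lam] xy by auto
  qed auto
  then have "card ?Z = card (real ` {1..<k})" "finite ?Z \<longleftrightarrow> finite (real ` {1..<k})"
    using card_image[of ?f ?Z] finite_image_iff[of ?f ?Z] unfolding img by auto
  then show ?thesis by (simp add: card_image)
qed

lemma multiple_of_U_in_S_plus:
  assumes k: "1 \<le> k" "angle lam 1 = real k * pi" and c: "0 < c"
    and v: "\<And>x. x \<in> {0..1} \<Longrightarrow> v x = c * U lam x"
  shows "v \<in> S_plus k"
proof -
  have "U lam 1 = 0" using k U_1_zero_iff by blast
  have v': "(v has_real_derivative c * phi q (V lam x)) (at x within {0..1})" if x: "x \<in> {0..1}" for x
    by (rule has_field_derivative_transform_within[where d = 1, OF DERIV_cmult[OF U_deriv[OF x]]])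
      (use x v in auto)
  have "v \<in> E"
    by (rule E_I[OF v']) (use cont_V q v UV_0 \<open>U lam 1 = 0\<close> in \<open>auto intro!: continuous_intros\<close>)
  moreover have zeros: "{x \<in> {0<..<1}. v x = 0} = {x \<in> {0<..<1}. U lam x = 0}"
    using v c by auto
  moreover have "deriv01 v x \<noteq> 0" if "x \<in> {0<..<1}" "v x = 0" for x
  proof -
    have "U lam x = 0" using that v[of x] c by auto
    then have "V lam x \<noteq> 0" using UV_nonzero[of lam x] by simp
    then show ?thesis using deriv01_eq[OF _ v'[of x]] that c by auto
  qed
  moreover have "\<forall>\<^sub>F x in at_right 0. 0 < v x"
    using eventually_pos_at_right_0[OF v'[of 0]] v[of 0] UV_0 c by simp
  ultimately show ?thesis
    using interior_zeros_of_U[OF k(2)] unfolding S_plus_def mem_Collect_eq zeros by blast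
qed

section \<open>The final angle as a function of the spectral parameter\<close>

lemma rot_diff:
  "rot \<mu> x \<theta> - rot lam x \<theta> = (\<mu> - lam) * (a x * \<bar>sin \<theta>\<bar> powr p / den \<theta>)"
  unfolding rot_def mult_force using den_pos[of \<theta>] by (simp add: field_simps)

lemma weight_bounds:
  "0 \<le> \<bar>sin \<theta>\<bar> powr p / den \<theta>" "\<bar>sin \<theta>\<bar> powr p / den \<theta> \<le> 1 / min 1 (p - 1)"
proof -
  show "0 \<le> \<bar>sin \<theta>\<bar> powr p / den \<theta>" using den_pos[of \<theta>] by simp
  have "\<bar>sin \<theta>\<bar> powr p \<le> 1" using powr_mono2[of p "\<bar>sin \<theta>\<bar>" 1] p by simp
  then show "\<bar>sin \<theta>\<bar> powr p / den \<theta> \<le> 1 / min 1 (p - 1)"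
    using p den_ge[of \<theta>] by (intro frac_le) auto
qed

lemma rot_mono:
  assumes "lam \<le> \<mu>" "x \<in> {0..1}"
  shows "rot lam x \<theta> \<le> rot \<mu> x \<theta>"
proof -
  have "0 \<le> a x" using a_pos[OF assms(2)] by simp
  then have "0 \<le> (\<mu> - lam) * (a x * (\<bar>sin \<theta>\<bar> powr p / den \<theta>))"
    using assms weight_bounds(1)[of \<theta>] by (intro mult_nonneg_nonneg) auto
  then have "0 \<le> rot \<mu> x \<theta> - rot lam x \<theta>" by (simp add: rot_diff)
  then show ?thesis by simp
qed

lemma angle_mono:
  assumes "lam \<le> \<mu>" "x \<in> {0..1}"
  shows "angle lam x \<le> angle \<mu> x"
proof -
  obtain L where L: "\<And>x s t. x \<in> {0..1} \<Longrightarrow> \<bar>rot lam x s - rot lam x t\<bar> \<le> L * \<bar>s - t\<bar>"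
    using rot_lipschitz by blast
  show ?thesis
  proof (rule comparison[where y = "angle lam" and z = "angle \<mu>" and a = 0 and L = L])
    show "continuous_on {0..x} (angle lam)" "continuous_on {0..x} (angle \<mu>)"
      using assms by (auto intro: continuous_on_subset[OF cont_angle])
    fix t assume t: "0 < t" "t < x"
    have "rot lam t (angle \<mu> t) \<le> rot \<mu> t (angle \<mu> t)"
      using t assms by (intro rot_mono) auto
    then have "rot lam t (angle lam t) - rot \<mu> t (angle \<mu> t) \<le> L * \<bar>angle lam t - angle \<mu> t\<bar>"
      using L[of t "angle lam t" "angle \<mu> t"] t assms by auto
    then show "\<exists>y' z'. (angle lam has_real_derivative y') (at t) \<and>
        (angle \<mu> has_real_derivative z') (at t) \<and> y' - z' \<le> L * \<bar>angle lam t - angle \<mu> t\<bar>"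
      using angle_DERIV[of t lam] angle_DERIV[of t \<mu>] t assms by auto
  qed (use assms angle(1) in auto)
qed

text \<open>If the two final angles agreed, Gronwall's inequality with the constant \<open>- L\<close> would carry the equality back
  to all of \<open>[0,1]\<close>.  Then \<open>rot\<close> would agree along the common angle for both parameters, which by
  \<open>rot_diff\<close> and \<open>a > 0\<close> is possible only where the sine vanishes; but the sine is positive near 0.\<close>

lemma angle_1_strict_mono:
  assumes "lam < \<mu>"
  shows "angle lam 1 < angle \<mu> 1"
proof (rule ccontr)
  assume "\<not> angle lam 1 < angle \<mu> 1"
  then have 1: "angle lam 1 = angle \<mu> 1" using angle_mono[of lam \<mu> 1] assms by simp
  obtain L where L: "\<And>x s t. x \<in> {0..1} \<Longrightarrow> \<bar>rot lam x s - rot lam x t\<bar> \<le> L * \<bar>s - t\<bar>"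
    using rot_lipschitz by blast
  have ge: "rot lam t (angle \<mu> t) \<le> rot \<mu> t (angle \<mu> t)" if "0 < t" "t < 1" for t
    using that assms by (intro rot_mono) auto
  have eq: "angle lam x = angle \<mu> x" if x: "0 \<le> x" "x \<le> 1" for x
  proof -
    have "angle lam 1 - angle \<mu> 1 \<le> (angle lam x - angle \<mu> x) * exp (- L * (1 - x))"
    proof (rule gronwall)
      show "continuous_on {x..1} (\<lambda>x. angle lam x - angle \<mu> x)"
        using x by (intro continuous_intros continuous_on_subset[OF cont_angle]) auto
      fix t assume t: "x < t" "t < 1"
      have "rot lam t (angle lam t) - rot lam t (angle \<mu> t) \<le> - L * (angle lam t - angle \<mu> t)"
        using L[of t "angle lam t" "angle \<mu> t"] t x angle_mono[of lam \<mu> t] assms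
        by (simp add: abs_le_iff right_diff_distrib)
      then have "rot lam t (angle lam t) - rot \<mu> t (angle \<mu> t) \<le> - L * (angle lam t - angle \<mu> t)"
        using ge[of t] t x by auto
      then show "\<exists>d. ((\<lambda>x. angle lam x - angle \<mu> x) has_real_derivative d) (at t) \<and>
          d \<le> - L * (angle lam t - angle \<mu> t)"
        using DERIV_diff[OF angle_DERIV[of t lam] angle_DERIV[of t \<mu>]] t x by auto
    qed (use x in auto)
    then have "0 \<le> angle lam x - angle \<mu> x" using 1 by (simp add: zero_le_mult_iff)
    then show ?thesis using angle_mono[of lam \<mu> x] assms x by simp
  qed
  have "sin (angle \<mu> x) = 0" if x: "0 < x" "x < 1" for x
  proof -
    have "\<forall>\<^sub>F t in nhds x. angle lam t = angle \<mu> t"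
      using eventually_nhds_in_open[of "{0<..<1}" x] x eq by (auto elim!: eventually_mono)
    then have "(angle \<mu> has_real_derivative rot lam x (angle lam x)) (at x)"
      using DERIV_cong_ev[OF refl _ refl, of "angle lam" "angle \<mu>" x] angle_DERIV[OF x] by blast
    then have "rot lam x (angle \<mu> x) = rot \<mu> x (angle \<mu> x)"
      using DERIV_unique angle_DERIV[OF x, of \<mu>] eq[of x] x by force
    then show ?thesis
      using rot_diff[of \<mu> x "angle \<mu> x" lam] assms a_pos[of x] x den_pos[of "angle \<mu> x"] by auto
  qed
  moreover obtain e where e: "0 < e" "\<forall>x > 0. x < e \<longrightarrow> 0 < U \<mu> x"
    using eventually_pos_at_right_0[OF U_deriv[of 0 \<mu>]] UV_0 by (auto simp: eventually_at_right_field)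
  ultimately have "sin (angle \<mu> (min (e / 2) (1 / 2))) = 0" "0 < U \<mu> (min (e / 2) (1 / 2))"
    by auto
  then show False by (simp add: U_def)
qed

text \<open>The squared difference \<open>d\<^sup>2\<close> of the angles for \<open>\<mu>\<close> and \<open>\<lambda>\<close> satisfies
  \<open>(d\<^sup>2)' \<le> K d\<^sup>2 + ((\<mu> - \<lambda>) G)\<^sup>2\<close> with \<open>K\<close> depending on \<open>\<lambda>\<close> only, so \<open>d(1)\<close> is at most
  of the order of \<open>\<mu> - \<lambda>\<close>.\<close>

lemma continuous_angle_1: "continuous_on UNIV (\<lambda>lam. angle lam 1)"
  unfolding continuous_on_def
proof
  fix lam :: real
  obtain L' where L': "\<And>x s t. x \<in> {0..1} \<Longrightarrow> \<bar>rot lam x s - rot lam x t\<bar> \<le> L' * \<bar>s - t\<bar>"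
    using rot_lipschitz by blast
  define L where "L = \<bar>L'\<bar>"
  have L: "\<bar>rot lam x s - rot lam x t\<bar> \<le> L * \<bar>s - t\<bar>" if "x \<in> {0..1}" for x s t
    by (rule order_trans[OF L'[OF that] mult_right_mono]) (auto simp: L_def)
  obtain M where M: "\<And>x. x \<in> {0..1} \<Longrightarrow> \<bar>a x\<bar> \<le> M \<and> \<bar>\<alpha> x\<bar> \<le> M \<and> \<bar>\<beta> x\<bar> \<le> M"
    using coefficient_bound by blast
  have "0 \<le> M" using M[of 0] by auto
  define G where "G = M * (1 / min 1 (p - 1))"
  define K where "K = 2 * L + 1"
  have K: "0 < K" by (simp add: K_def L_def)
  have bound: "(angle \<mu> 1 - angle lam 1)\<^sup>2 \<le> ((\<mu> - lam) * G)\<^sup>2 / K * exp K" for \<mu>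
  proof -
    \<comment> \<open>adding \<open>c\<close> to the squared difference absorbs the inhomogeneous term\<close>
    define c where "c = ((\<mu> - lam) * G)\<^sup>2 / K"
    have c: "0 \<le> c" "K * c = ((\<mu> - lam) * G)\<^sup>2" using K by (auto simp: c_def)
    have "(angle \<mu> 1 - angle lam 1)\<^sup>2 + c \<le> ((angle \<mu> 0 - angle lam 0)\<^sup>2 + c) * exp (K * (1 - 0))"
    proof (rule gronwall)
      show "continuous_on {0..1} (\<lambda>x. (angle \<mu> x - angle lam x)\<^sup>2 + c)"
        by (intro continuous_intros cont_angle)
      fix t :: real assume t: "0 < t" "t < 1"
      define d where "d = angle \<mu> t - angle lam t"
      define w where "w = a t * \<bar>sin (angle \<mu> t)\<bar> powr p / den (angle \<mu> t)"
      have w: "\<bar>w\<bar> \<le> G"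
        unfolding w_def G_def times_divide_eq_right[symmetric] abs_mult
        using M[of t] t weight_bounds[of "angle \<mu> t"] \<open>0 \<le> M\<close> by (intro mult_mono) auto
      have "((\<lambda>x. (angle \<mu> x - angle lam x)\<^sup>2 + c) has_real_derivative
          2 * d * (rot \<mu> t (angle \<mu> t) - rot lam t (angle lam t))) (at t)"
        using angle_DERIV[OF t, of \<mu>] angle_DERIV[OF t, of lam]
        by (auto simp: d_def intro!: derivative_eq_intros)
      moreover have "2 * d * (rot \<mu> t (angle \<mu> t) - rot lam t (angle lam t)) \<le> K * (d\<^sup>2 + c)"
      proof -
        have "rot \<mu> t (angle \<mu> t) - rot lam t (angle lam t) =
            (rot lam t (angle \<mu> t) - rot lam t (angle lam t)) + (\<mu> - lam) * w"
          using rot_diff[of \<mu> t "angle \<mu> t" lam] by (simp add: w_def)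
        from arg_cong[OF this, of "\<lambda>s. 2 * d * s"] have "2 * d * (rot \<mu> t (angle \<mu> t) - rot lam t (angle lam t)) =
            2 * (d * (rot lam t (angle \<mu> t) - rot lam t (angle lam t))) + 2 * d * ((\<mu> - lam) * w)"
          by (simp only: distrib_left mult.assoc)
        moreover have "d * (rot lam t (angle \<mu> t) - rot lam t (angle lam t)) \<le> L * d\<^sup>2"
        proof -
          have "d * (rot lam t (angle \<mu> t) - rot lam t (angle lam t)) \<le>
              \<bar>d\<bar> * \<bar>rot lam t (angle \<mu> t) - rot lam t (angle lam t)\<bar>"
            by (metis abs_ge_self abs_mult)
          also have "\<dots> \<le> \<bar>d\<bar> * (L * \<bar>d\<bar>)"
            using L[of t] t by (intro mult_left_mono) (auto simp: d_def)
          finally show ?thesis by (simp add: power2_eq_square mult_ac)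
        qed
        moreover have "2 * d * ((\<mu> - lam) * w) \<le> d\<^sup>2 + ((\<mu> - lam) * w)\<^sup>2"
          using sum_squares_bound[of d "(\<mu> - lam) * w"] by simp
        moreover have "((\<mu> - lam) * w)\<^sup>2 \<le> ((\<mu> - lam) * G)\<^sup>2"
          using w by (simp add: power_mult_distrib mult_left_mono abs_le_square_iff[symmetric])
        ultimately have "2 * d * (rot \<mu> t (angle \<mu> t) - rot lam t (angle lam t)) \<le>
            2 * (L * d\<^sup>2) + (d\<^sup>2 + K * c)" using c by linarith
        then show ?thesis by (simp add: K_def algebra_simps)
      qed
      ultimately show "\<exists>D. ((\<lambda>x. (angle \<mu> x - angle lam x)\<^sup>2 + c) has_real_derivative D) (at t) \<and>
          D \<le> K * ((angle \<mu> t - angle lam t)\<^sup>2 + c)"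
        unfolding d_def by blast
    qed simp
    then show ?thesis using c angle(1) by (simp add: c_def)
  qed
  have "((\<lambda>\<mu>. ((\<mu> - lam) * G)\<^sup>2 / K * exp K) \<longlongrightarrow> ((lam - lam) * G)\<^sup>2 / K * exp K) (at lam)"
    using K by (intro tendsto_intros) auto
  then have lim: "((\<lambda>\<mu>. ((\<mu> - lam) * G)\<^sup>2 / K * exp K) \<longlongrightarrow> 0) (at lam)" by simp
  have "((\<lambda>\<mu>. (angle \<mu> 1 - angle lam 1)\<^sup>2) \<longlongrightarrow> 0) (at lam)"
    by (rule tendsto_sandwich[OF _ _ tendsto_const lim]) (use bound in \<open>simp_all only: eventually_True zero_le_power2\<close>)
  then have "((\<lambda>\<mu>. sqrt ((angle \<mu> 1 - angle lam 1)\<^sup>2)) \<longlongrightarrow> sqrt 0) (at lam)"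
    by (rule tendsto_real_sqrt)
  then have "((\<lambda>\<mu>. angle \<mu> 1 - angle lam 1) \<longlongrightarrow> 0) (at lam)"
    by (simp add: tendsto_rabs_zero_iff)
  then show "((\<lambda>\<mu>. angle \<mu> 1) \<longlongrightarrow> angle lam 1) (at lam)"
    by (rule Lim_null[THEN iffD2])
qed

text \<open>For very negative \<open>lam\<close> the coefficient \<open>lam * a + \<alpha>\<close> is negative, and it is the value of \<open>rot\<close> at
  \<open>\<pi>/2\<close>.  So the angle cannot pass \<open>\<pi>/2\<close> upwards.\<close>

lemma angle_1_lt_pi: "\<exists>lam. angle lam 1 < pi"
proof -
  obtain M where M: "\<And>x. x \<in> {0..1} \<Longrightarrow> \<bar>a x\<bar> \<le> M \<and> \<bar>\<alpha> x\<bar> \<le> M \<and> \<bar>\<beta> x\<bar> \<le> M"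
    using coefficient_bound by blast
  obtain x0 where x0: "x0 \<in> {0..1}" "\<And>x. x \<in> {0..1} \<Longrightarrow> a x0 \<le> a x"
    using continuous_attains_inf[of "{0..1}" a] cont_a by auto
  have a0: "0 < a x0" using x0 a_pos by auto
  define lam where "lam = - ((M + 1) / a x0)"
  have neg: "lam * a x + \<alpha> x < 0" if "x \<in> {0..1}" for x
  proof -
    have "0 \<le> M" using M[OF that] by auto
    then have "lam * a x \<le> lam * a x0"
      using x0(2)[OF that] a0 by (intro mult_left_mono_neg) (auto simp: lam_def)
    also have "\<dots> = - (M + 1)" using a0 by (simp add: lam_def)
    finally show ?thesis using M[OF that] by auto
  qed
  have "0 < pi / 2 - angle lam 1"
  proof (rule crosses_upwards[of 0 1])
    show "continuous_on {0..1} (\<lambda>x. pi / 2 - angle lam x)"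
      by (intro continuous_intros cont_angle)
    fix x :: real assume x: "0 \<le> x" "x \<le> 1" "pi / 2 - angle lam x = 0"
    then have "angle lam x = pi / 2" by simp
    have "rot lam x (angle lam x) = lam * a x + \<alpha> x"
      unfolding \<open>angle lam x = pi / 2\<close> by (simp add: rot_def den_def rhs_def pos_part_def neg_part_def)
    then show "\<exists>d > 0. ((\<lambda>x. pi / 2 - angle lam x) has_real_derivative d) (at x within {0..1})"
      using x neg[of x] angle(2)[of x lam]
      by (intro exI[of _ "- (lam * a x + \<alpha> x)"]) (auto intro!: derivative_eq_intros)
  qed (use angle(1) in auto)
  then show ?thesis using pi_gt_zero by (intro exI[of _ lam]) linarith
qed

text \<open>If both coefficients \<open>lam * a + \<alpha>\<close> and \<open>lam * a - \<beta>\<close> are at least \<open>1 + n\<close>, then \<open>rot\<close> is at least the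
  reciprocal of \<open>slowness n\<close>, and the integral of \<open>slowness n\<close> over a range of angles bounds the time
  in which the angle traverses this range.  The summand 1 keeps the denominator positive for \<open>n = 0\<close>, so that
  \<open>slowness 0\<close> is an integrable majorant of the whole sequence.\<close>

definition slowness where
  "slowness n \<theta> = den \<theta> / ((p - 1) * \<bar>cos \<theta>\<bar> powr q + (1 + real n) * \<bar>sin \<theta>\<bar> powr p)"

lemma slowness_denominator_pos:
  "0 < (p - 1) * \<bar>cos \<theta>\<bar> powr q + (1 + real n) * \<bar>sin \<theta>\<bar> powr p"
proof (cases "sin \<theta> = 0")
  case True
  then show ?thesis using p sin_zero_abs_cos_one[of \<theta>] by simp
next
  case False
  then have "0 < (1 + real n) * \<bar>sin \<theta>\<bar> powr p" by (intro mult_pos_pos) auto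
  then show ?thesis using p by (intro add_nonneg_pos) auto
qed

lemma slowness_pos: "0 < slowness n \<theta>"
  unfolding slowness_def using den_pos slowness_denominator_pos by simp

lemma cont_slowness: "continuous_on S (slowness n)"
proof -
  have "\<forall>\<theta> \<in> S. (p - 1) * \<bar>cos \<theta>\<bar> powr q + (1 + real n) * \<bar>sin \<theta>\<bar> powr p \<noteq> 0"
    using slowness_denominator_pos[THEN less_imp_neq, THEN not_sym] by blast
  then have "continuous_on S (\<lambda>\<theta>. ((p - 1) * (cos \<theta>)\<^sup>2 + (sin \<theta>)\<^sup>2) /
      ((p - 1) * \<bar>cos \<theta>\<bar> powr q + (1 + real n) * \<bar>sin \<theta>\<bar> powr p))"
    by (intro continuous_on_divide) (use p q(1) in \<open>auto intro!: continuous_intros continuous_on_powr'\<close>)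
  then show ?thesis by (simp add: slowness_def[abs_def] den_def)
qed

text \<open>Pointwise \<open>slowness n \<theta>\<close> tends to 0 unless \<open>\<theta>\<close> is a multiple of \<open>\<pi>\<close>.\<close>

lemma integral_slowness_tendsto_0: "(\<lambda>n. integral {0..c} (slowness n)) \<longlonglongrightarrow> 0"
proof -
  define g where "g \<theta> = (if sin \<theta> = 0 then 1 else 0 :: real)" for \<theta> :: real
  have lim: "(\<lambda>n. slowness n \<theta>) \<longlonglongrightarrow> g \<theta>" for \<theta>
  proof (cases "sin \<theta> = 0")
    case True
    then have "slowness n \<theta> = 1" for n
      using p sin_zero_abs_cos_one[of \<theta>] sin_cos_squared_add[of \<theta>] by (simp add: slowness_def den_def)
    then show ?thesis using True by (simp add: g_def)
  next
    case False
    have "filterlim (\<lambda>n. (1 + real n) * \<bar>sin \<theta>\<bar> powr p) at_top sequentially"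
      using False by (intro filterlim_at_top_mult_tendsto_pos[OF tendsto_const]
          filterlim_tendsto_add_at_top[OF tendsto_const] filterlim_real_sequentially) auto
    then have "filterlim (\<lambda>n. (p - 1) * \<bar>cos \<theta>\<bar> powr q + (1 + real n) * \<bar>sin \<theta>\<bar> powr p) at_top sequentially"
      by (rule filterlim_tendsto_add_at_top[OF tendsto_const])
    then have "(\<lambda>n. slowness n \<theta>) \<longlonglongrightarrow> 0"
      unfolding slowness_def
      by (intro tendsto_divide_0[OF tendsto_const] filterlim_at_top_imp_at_infinity)
    then show ?thesis using False by (simp add: g_def)
  qed
  have "(\<lambda>n. integral {0..c} (slowness n)) \<longlonglongrightarrow> integral {0..c} g"
  proof (rule dominated_convergence(2)[where h = "slowness 0"])
    show "slowness n integrable_on {0..c}" for n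
      by (rule integrable_continuous_interval[OF cont_slowness])
    then show "slowness 0 integrable_on {0..c}" .
    show "norm (slowness n \<theta>) \<le> slowness 0 \<theta>" for n \<theta>
    proof -
      have "slowness n \<theta> \<le> slowness 0 \<theta>"
        unfolding slowness_def
        using slowness_denominator_pos[of \<theta> n] slowness_denominator_pos[of \<theta> 0] den_pos[of \<theta>]
        by (intro divide_left_mono mult_pos_pos add_left_mono mult_right_mono) auto
      then show ?thesis using slowness_pos[of n \<theta>] by simp
    qed
  qed (use lim in auto)
  also have "integral {0..c} g = integral {0..c} (\<lambda>_. 0)"
  proof (rule integral_spike)
    show "negligible ({0..c} \<inter> {\<theta>. sin \<theta> = 0})"
    proof -
      have "{\<theta> :: real. sin \<theta> = 0} = range (\<lambda>i :: int. of_int i * pi)"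
        by (auto simp: sin_zero_iff_int2)
      then have "countable ({0..c} \<inter> {\<theta>. sin \<theta> = 0})" by auto
      then show ?thesis
        by (simp add: negligible_iff_null_sets countable_imp_null_set_lborel null_sets_completionI)
    qed
  qed (auto simp: g_def)
  finally show ?thesis by simp
qed

text \<open>Otherwise the angle would stay in \<open>{0..c}\<close>, \<open>c = k \<pi>\<close>, for every parameter.  With \<open>H\<close> the antiderivative of
  \<open>slowness n\<close> the function \<open>H (angle lam x) - x\<close> is nondecreasing if \<open>lam\<close> is large, depending on \<open>n\<close>, whence
  \<open>1 \<le> H c\<close>; but \<open>H c\<close> tends to 0 as \<open>n\<close> grows.\<close>

lemma angle_1_unbounded: "\<exists>lam. real k * pi \<le> angle lam 1"
proof (rule ccontr)
  assume "\<nexists>lam. real k * pi \<le> angle lam 1"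
  then have less: "angle lam 1 < real k * pi" for lam by (auto simp: not_le)
  define c where "c = real k * pi"
  have "\<forall>\<^sub>F n in sequentially. integral {0..c} (slowness n) < 1"
    using integral_slowness_tendsto_0 by (rule order_tendstoD) simp
  then obtain n where n: "integral {0..c} (slowness n) < 1"
    using eventually_happens[of _ sequentially] by auto
  define H where "H t = integral {0..t} (slowness n)" for t
  obtain M where M: "\<And>x. x \<in> {0..1} \<Longrightarrow> \<bar>a x\<bar> \<le> M \<and> \<bar>\<alpha> x\<bar> \<le> M \<and> \<bar>\<beta> x\<bar> \<le> M"
    using coefficient_bound by blast
  have "0 \<le> M" using M[of 0] by auto
  obtain x0 where x0: "x0 \<in> {0..1}" "\<And>x. x \<in> {0..1} \<Longrightarrow> a x0 \<le> a x"
    using continuous_attains_inf[of "{0..1}" a] cont_a by auto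
  have a0: "0 < a x0" using x0 a_pos by auto
  define lam where "lam = (1 + real n + M) / a x0"
  have rot_ge: "1 \<le> slowness n \<theta> * rot lam x \<theta>" if x: "x \<in> {0..1}" for x \<theta>
  proof -
    have "1 + real n + M = lam * a x0" using a0 by (simp add: lam_def)
    also have "\<dots> \<le> lam * a x"
      using x0(2)[OF x] a0 \<open>0 \<le> M\<close> by (intro mult_left_mono) (auto simp: lam_def)
    finally have la: "1 + real n + M \<le> lam * a x" .
    have "(1 + real n) * \<bar>sin \<theta>\<bar> powr p \<le> sin \<theta> * force lam x (sin \<theta>)"
    proof (cases "0 \<le> sin \<theta>")
      case True
      then have "sin \<theta> * force lam x (sin \<theta>) = (lam * a x + \<alpha> x) * \<bar>sin \<theta>\<bar> powr p"
        unfolding mult_force by (simp add: pos_part_def neg_part_def algebra_simps)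
      then show ?thesis using la M[OF x] by (auto intro!: mult_right_mono)
    next
      case False
      then have "sin \<theta> * force lam x (sin \<theta>) = (lam * a x - \<beta> x) * \<bar>sin \<theta>\<bar> powr p"
        unfolding mult_force by (simp add: pos_part_def neg_part_def algebra_simps)
      then show ?thesis using la M[OF x] by (auto intro!: mult_right_mono)
    qed
    then show ?thesis
      using den_pos[of \<theta>] slowness_denominator_pos[of \<theta> n]
      by (simp add: slowness_def rot_def)
  qed
  have range: "0 < angle lam x \<and> angle lam x < c" if "0 < x" "x < 1" for x
    using that angle_pos[of x lam] angle_crosses[of x 1 k lam] less[of lam] by (force simp: c_def)
  have H': "(H has_real_derivative slowness n t) (at t within {0..c})" if "t \<in> {0..c}" for t
    unfolding H_def by (rule integral_has_real_derivative[OF cont_slowness that])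
  have "0 \<le> c" by (simp add: c_def)
  have "H (angle lam 0) - 0 \<le> H (angle lam 1) - 1"
  proof (rule DERIV_nonneg_imp_increasing_open[of 0 1 "\<lambda>x. H (angle lam x) - x"])
    have "angle lam x \<in> {0..c}" if "x \<in> {0..1}" for x
    proof (cases "x = 0 \<or> x = 1")
      case True
      then show ?thesis
        using angle(1)[of lam] angle_pos[of 1 lam] less[of lam] \<open>0 \<le> c\<close> by (auto simp: c_def)
    next
      case False
      then show ?thesis using range[of x] that by auto
    qed
    then have "angle lam ` {0..1} \<subseteq> {0..c}" by blast
    moreover have "continuous_on {0..c} H" using H' by (rule DERIV_continuous_on)
    ultimately have "continuous_on {0..1} (\<lambda>x. H (angle lam x))"
      using continuous_on_compose2[OF _ cont_angle] by blast
    then show "continuous_on {0..1} (\<lambda>x. H (angle lam x) - x)" by (intro continuous_intros)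
    fix x :: real assume x: "0 < x" "x < 1"
    have "(H has_real_derivative slowness n (angle lam x)) (at (angle lam x))"
      using H'[of "angle lam x"] range[OF x] at_within_Icc_at[of 0 "angle lam x" c] by auto
    from DERIV_chain2[OF this angle_DERIV[OF x]]
    have "((\<lambda>x. H (angle lam x) - x) has_real_derivative
        slowness n (angle lam x) * rot lam x (angle lam x) - 1) (at x)"
      by (auto intro!: derivative_eq_intros)
    then show "\<exists>d. ((\<lambda>x. H (angle lam x) - x) has_real_derivative d) (at x) \<and> 0 \<le> d"
      using rot_ge[of x "angle lam x"] x by (intro exI conjI) auto
  qed simp
  then have "1 \<le> H (angle lam 1)" by (simp add: angle(1) H_def)
  also have "\<dots> \<le> H c"
    unfolding H_def using less[of lam] angle_pos[of 1 lam] slowness_pos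
    by (intro integral_subset_le integrable_continuous_interval cont_slowness)
      (auto simp: c_def less_imp_le)
  finally show False using n by (simp add: H_def)
qed

section \<open>The half-eigenvalues\<close>

lemma ex_half_eigenvalue:
  assumes "1 \<le> k"
  shows "\<exists>lam. angle lam 1 = real k * pi"
proof -
  obtain l where l: "angle l 1 < pi" using angle_1_lt_pi by blast
  obtain m where m: "real k * pi \<le> angle m 1" using angle_1_unbounded by blast
  have "pi \<le> real k * pi" using assms by simp
  then have "angle l 1 \<le> real k * pi" "angle l 1 < angle m 1" using l m by linarith+
  then have "l < m" using angle_mono[of m l 1] by (cases "l < m") auto
  have "\<exists>x \<ge> l. x \<le> m \<and> angle x 1 = real k * pi"
    by (rule IVT'[of "\<lambda>x. angle x 1"])
      (use \<open>angle l 1 \<le> real k * pi\<close> m \<open>l < m\<close> in \<open>auto intro: continuous_on_subset[OF continuous_angle_1]\<close>)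
  then show ?thesis by blast
qed

definition half_eig where "half_eig k = (SOME lam. angle lam 1 = real k * pi)"

lemma angle_half_eig: "1 \<le> k \<Longrightarrow> angle (half_eig k) 1 = real k * pi"
  unfolding half_eig_def using someI_ex[OF ex_half_eigenvalue] by blast

lemma half_eig_strict_mono: "strict_mono_on {1..} half_eig"
proof (rule strict_mono_onI)
  fix j k :: nat assume jk: "j \<in> {1..}" "k \<in> {1..}" "j < k"
  then have "angle (half_eig j) 1 < angle (half_eig k) 1" by (simp add: angle_half_eig)
  then show "half_eig j < half_eig k"
    using angle_mono[of "half_eig k" "half_eig j" 1] by (cases "half_eig j < half_eig k") auto
qed

lemma eigenfunction: "1 \<le> k \<Longrightarrow> nontrivial_solution p a \<alpha> \<beta> (half_eig k) (U (half_eig k))"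
  using U_solution U_1_zero_iff angle_half_eig by blast

text \<open>By \<open>solution_eq_U\<close> the boundary condition at 1 says that the final angle is a multiple of \<open>\<pi>\<close>, and strict
  monotonicity leaves no other parameter than \<open>half_eig k\<close>.\<close>

lemma positive_solution_is_eigenfunction:
  assumes "nontrivial_solution p a \<alpha> \<beta> lam u" "0 < deriv01 u 0"
  shows "\<exists>k \<ge> 1. lam = half_eig k \<and> (\<exists>c > 0. \<forall>x \<in> {0..1}. u x = c * U (half_eig k) x)"
proof -
  have "U lam 1 = 0"
    using solution_eq_U[OF assms, of 1] assms by (auto simp: nontrivial_solution_def solution_def E_def)
  then obtain k where k: "1 \<le> k" "angle lam 1 = real k * pi" using U_1_zero_iff by blast
  have "lam = half_eig k"
    using angle_1_strict_mono[of lam "half_eig k"] angle_1_strict_mono[of "half_eig k" lam]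
      k angle_half_eig[OF k(1)] by (cases lam "half_eig k" rule: linorder_cases) auto
  then show ?thesis using k solution_eq_U[OF assms] assms(2) by auto
qed

end

text \<open>Translates the sign condition in the notion of simplicity into one on the derivatives at 0, which
  distinguish the two families of solutions.\<close>

lemma deriv01_0_same_sign:
  assumes "u \<in> E" "v \<in> E" and ev: "\<forall>\<^sub>F x in at_right 0. 0 < u x * v x"
    and "0 < deriv01 u 0" "deriv01 v 0 \<noteq> 0"
  shows "0 < deriv01 v 0"
proof (rule ccontr)
  have d: "(w has_real_derivative deriv01 w 0) (at 0 within {0..1})" if "w \<in> E" for w
    using that by (auto simp: E_def intro: has_real_derivative_deriv01)
  assume "\<not> 0 < deriv01 v 0"
  then have "\<forall>\<^sub>F x in at_right 0. 0 < - v x"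
    using eventually_pos_at_right_0[OF DERIV_minus[OF d[OF assms(2)]]] assms by (auto simp: E_def)
  moreover have "\<forall>\<^sub>F x in at_right 0. 0 < u x"
    using eventually_pos_at_right_0[OF d[OF assms(1)]] assms by (auto simp: E_def)
  ultimately have "\<forall>\<^sub>F x in at_right (0 :: real). False"
    using ev by eventually_elim (auto simp: zero_less_mult_iff)
  then show False by simp
qed

lemma (in half_quasilinear) mirrored: "half_quasilinear p a (\<lambda>x. - \<beta> x) (\<lambda>x. - \<alpha> x)"
  using p cont_a a_pos cont_\<alpha> cont_\<beta> by unfold_locales (auto intro: continuous_intros)

lemma (in half_quasilinear) half_eigenvalue_simple:
  assumes "nontrivial_solution p a \<alpha> \<beta> lam w"
  shows "simple_half_eigenvalue p a \<alpha> \<beta> lam"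
proof -
  interpret M: half_quasilinear p a "\<lambda>x. - \<beta> x" "\<lambda>x. - \<alpha> x" by (rule mirrored)
  have "\<exists>c > 0. \<forall>x \<in> {0..1}. v x = c * u x"
    if u: "nontrivial_solution p a \<alpha> \<beta> lam u" and v: "nontrivial_solution p a \<alpha> \<beta> lam v"
      and ev: "\<forall>\<^sub>F x in at_right 0. 0 < u x * v x" for u v
  proof -
    have E: "u \<in> E" "v \<in> E" using u v by (auto simp: nontrivial_solution_def solution_def)
    note nz = deriv01_0_nonzero[OF u] deriv01_0_nonzero[OF v]
    show ?thesis
    proof (cases "0 < deriv01 u 0")
      case True
      then show ?thesis using proportional[OF u v] deriv01_0_same_sign[OF E ev] nz by blast
    next
      case False
      then have 1: "0 < deriv01 (\<lambda>x. - u x) 0" using nz deriv01_minus[OF E(1), of 0] by simp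
      have m: "(\<lambda>x. - u x) \<in> E" "(\<lambda>x. - v x) \<in> E"
        using nontrivial_solution_minus[OF u] nontrivial_solution_minus[OF v]
        by (auto simp: nontrivial_solution_def solution_def)
      then have "0 < deriv01 (\<lambda>x. - v x) 0"
        using 1 ev nz(2) deriv01_minus[OF E(2), of 0]
        by (intro deriv01_0_same_sign[of "\<lambda>x. - u x" "\<lambda>x. - v x"]) auto
      then show ?thesis
        using M.proportional[OF nontrivial_solution_minus[OF u] nontrivial_solution_minus[OF v] 1]
        by simp
    qed
  qed
  then show ?thesis
    using assms by (auto simp: simple_half_eigenvalue_def half_eigenvalue_def)
qed

theorem theorem1p2:
  fixes p :: real and a \<alpha> \<beta> :: "real \<Rightarrow> real"
  assumes "1 < p"
    and "continuous_on {0..1} a" and "\<forall>x \<in> {0..1}. 0 < a x"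
    and "continuous_on {0..1} \<alpha>" and "continuous_on {0..1} \<beta>"
  shows "\<exists>(lam_plus :: nat \<Rightarrow> real) (lam_minus :: nat \<Rightarrow> real)
            (u_plus :: nat \<Rightarrow> real \<Rightarrow> real) (u_minus :: nat \<Rightarrow> real \<Rightarrow> real).
    strict_mono_on {1..} lam_plus \<and> strict_mono_on {1..} lam_minus \<and>
    (\<forall>k \<ge> 1. simple_half_eigenvalue p a \<alpha> \<beta> (lam_plus k) \<and>
             simple_half_eigenvalue p a \<alpha> \<beta> (lam_minus k)) \<and>
    (\<forall>k \<ge> 1. nontrivial_solution p a \<alpha> \<beta> (lam_plus k) (u_plus k) \<and>
             nontrivial_solution p a \<alpha> \<beta> (lam_minus k) (u_minus k)) \<and>
    (\<forall>k \<ge> 1. half_line (lam_plus k) (u_plus k) \<subseteq> {lam_plus k} \<times> S_plus k \<and>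
             half_line (lam_minus k) (u_minus k) \<subseteq> {lam_minus k} \<times> S_minus k) \<and>
    {(lam, u). nontrivial_solution p a \<alpha> \<beta> lam u} =
      (\<Union>k \<in> {1..}. half_line (lam_plus k) (u_plus k) \<union> half_line (lam_minus k) (u_minus k))"
proof -
  interpret P: half_quasilinear p a \<alpha> \<beta>
    using assms by unfold_locales auto
  interpret M: half_quasilinear p a "\<lambda>x. - \<beta> x" "\<lambda>x. - \<alpha> x"
    by (rule P.mirrored)
  define u_plus where "u_plus k = P.U (P.half_eig k)" for k
  \<comment> \<open>the negative family is the reflected positive family of the mirrored problem \<open>M\<close>\<close>
  define u_minus where "u_minus k = (\<lambda>x. - M.U (M.half_eig k) x)" for k
  have plus: "nontrivial_solution p a \<alpha> \<beta> (P.half_eig k) (u_plus k)" if "1 \<le> k" for k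
    using P.eigenfunction[OF that] by (simp add: u_plus_def)
  have minus: "nontrivial_solution p a \<alpha> \<beta> (M.half_eig k) (u_minus k)" if "1 \<le> k" for k
    using nontrivial_solution_minus[OF M.eigenfunction[OF that]] by (simp add: u_minus_def)
  have S_plus: "half_line (P.half_eig k) (u_plus k) \<subseteq> {P.half_eig k} \<times> S_plus k" if "1 \<le> k" for k
    using P.multiple_of_U_in_S_plus[OF that P.angle_half_eig[OF that]]
    by (auto simp: half_line_def u_plus_def)
  have S_minus: "half_line (M.half_eig k) (u_minus k) \<subseteq> {M.half_eig k} \<times> S_minus k" if "1 \<le> k" for k
  proof -
    have "v \<in> S_minus k" if "0 < c" "\<forall>x \<in> {0..1}. v x = c * u_minus k x" for c v
    proof -
      have "(\<lambda>x. - v x) \<in> S_plus k"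
        using M.multiple_of_U_in_S_plus[OF \<open>1 \<le> k\<close> M.angle_half_eig[OF \<open>1 \<le> k\<close>]] that
        by (auto simp: u_minus_def)
      then show ?thesis unfolding S_minus_def by (rule rev_image_eqI) simp
    qed
    then show ?thesis by (auto simp: half_line_def)
  qed
  have classify: "\<exists>k \<ge> 1. (lam, u) \<in> half_line (P.half_eig k) (u_plus k) \<union> half_line (M.half_eig k) (u_minus k)"
    if u: "nontrivial_solution p a \<alpha> \<beta> lam u" for lam u
  proof (cases "0 < deriv01 u 0")
    case True
    then show ?thesis
      using P.positive_solution_is_eigenfunction[OF u] by (auto simp: half_line_def u_plus_def)
  next
    case False
    have "u \<in> E" using u by (simp add: nontrivial_solution_def solution_def)
    then have "0 < deriv01 (\<lambda>x. - u x) 0"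
      using False P.deriv01_0_nonzero[OF u] deriv01_minus[of u 0] by simp
    from M.positive_solution_is_eigenfunction[OF nontrivial_solution_minus[OF u] this]
    show ?thesis by (force simp: half_line_def u_minus_def)
  qed
  have solves: "nontrivial_solution p a \<alpha> \<beta> lam v"
    if "(lam, v) \<in> half_line lam' w" "nontrivial_solution p a \<alpha> \<beta> lam' w" for lam lam' v w
    using that nontrivial_solution_mult by (auto simp: half_line_def)
  have simple: "simple_half_eigenvalue p a \<alpha> \<beta> (P.half_eig k)"
    "simple_half_eigenvalue p a \<alpha> \<beta> (M.half_eig k)" if "1 \<le> k" for k
    using that plus minus P.half_eigenvalue_simple by blast+
  show ?thesis
  proof (rule exI[of _ P.half_eig], rule exI[of _ M.half_eig], rule exI[of _ u_plus],
      rule exI[of _ u_minus], intro conjI allI impI)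
    show "{(lam, u). nontrivial_solution p a \<alpha> \<beta> lam u} =
      (\<Union>k \<in> {1..}. half_line (P.half_eig k) (u_plus k) \<union> half_line (M.half_eig k) (u_minus k))"
      using classify solves plus minus by fastforce
  qed (use plus minus S_plus S_minus simple P.half_eig_strict_mono M.half_eig_strict_mono
      in auto)
qed

end
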